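(* Let $A:C_0(\mathbb R^2,\mathbb R^2)\to\mathbb R^2$ be a bounded linear map with compact support. Suppose $A$ is symmetric, that is, there exist $a,b,e\in C_0(\mathbb R^2)^*$ such that $$A=\begin{pmatrix}a&b\\ b&e\end{pmatrix}.$$ Additionally, suppose that $A\nabla g=0$ for every $g\in C_0^\infty(\mathbb R^2)$. Then there exists $c\in C_c(\mathbb R^2)$ such that for all $\mathbf U\in C_0^\infty(\mathbb R^2,\mathbb R^2)$: $$A\mathbf U=\iint_{\mathbb R^2}c\,[\,i\nabla\operatorname{curl}\mathbf U\,]\,dx\,dy .$$
   Context: $C_c(\mathbb R^2)$ is the space of continuous compactly supported functions $\mathbb R^2\to\mathbb R$. $C_0(\mathbb R^2,Y)$ is the Banach space of continuous functions $\mathbb R^2\to Y$ vanishing at infinity, with the supremum norm, and $C_0(\mathbb R^2)=C_0(\mathbb R^2,\mathbb R)$. $C_0^\infty(\mathbb R^2,Y)$ is the space of infinitely differentiable compactly supported functions, and $C_0^\infty(\mathbb R^2)=C_0^\infty(\mathbb R^2,\mathbb R)$. By the Riesz Representation Theorem, $A$ is a $2\times2$ matrix of finite signed measures on $\mathbb R^2$; $A$ has compact support if these measures do. The matrix notation means $A(U_1,U_2)=(a(U_1)+b(U_2),\,b(U_1)+e(U_2))$. For $\mathbf U=(U_1,U_2)$, $\operatorname{curl}\mathbf U=\partial_xU_2-\partial_yU_1$, and $i$ denotes rotation by $90^\circ$, $i(u,v)=(-v,u)$. *)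

theory Defs
  imports "HOL-Analysis.Analysis"
begin

section \<open>The Banach space of continuous functions vanishing at infinity\<close>

definition vanishing_functions :: "('a::euclidean_space \<Rightarrow> 'b::real_normed_vector) set"
  where "vanishing_functions = {f. continuous_on UNIV f \<and> (f \<longlongrightarrow> 0) at_infinity}"

typedef (overloaded) ('a, 'b) c0 =
  "vanishing_functions :: ('a::euclidean_space \<Rightarrow> 'b::real_normed_vector) set"
  morphisms apply_c0 C0
  by (rule exI[of _ "\<lambda>_. 0"]) (simp add: vanishing_functions_def)

declare [[coercion "apply_c0 :: ('a::euclidean_space, 'b::real_normed_vector) c0 \<Rightarrow> 'a \<Rightarrow> 'b"]]

setup_lifting type_definition_c0

lemma c0_eqI: "(\<And>x. apply_c0 f x = apply_c0 g x) \<Longrightarrow> f = g"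
  by transfer auto

lemma vanishing_functions_bounded:
  fixes f :: "'a::euclidean_space \<Rightarrow> 'b::real_normed_vector"
  assumes "f \<in> vanishing_functions"
  shows "bounded (range f)"
proof -
  have cont: "continuous_on UNIV f" and lim: "(f \<longlongrightarrow> 0) at_infinity"
    using assms by (auto simp: vanishing_functions_def)
  from tendstoD[OF lim zero_less_one] obtain B where B: "\<And>x. B \<le> norm x \<Longrightarrow> norm (f x) < 1"
    by (auto simp: eventually_at_infinity)
  have "bounded (f ` cball 0 B)"
    by (intro compact_imp_bounded compact_continuous_image continuous_on_subset[OF cont]) auto
  moreover have "bounded (f ` (- cball 0 B))"
    using B by (intro boundedI[where B = 1]) (auto simp: less_imp_le)
  ultimately have "bounded (f ` cball 0 B \<union> f ` (- cball 0 B))"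
    by (simp add: bounded_Un)
  then show ?thesis
    by (rule bounded_subset) auto
qed

lemma vanishing_functions_bdd_above:
  "f \<in> vanishing_functions \<Longrightarrow> bdd_above (range (\<lambda>x. norm (f x)))"
  using vanishing_functions_bounded[of f]
  by (auto simp: bounded_iff bdd_above_def)

instantiation c0 :: (euclidean_space, real_normed_vector) real_vector
begin

lift_definition uminus_c0 :: "('a, 'b) c0 \<Rightarrow> ('a, 'b) c0" is "\<lambda>f x. - f x"
  using tendsto_minus[of _ 0 at_infinity]
  by (auto simp: vanishing_functions_def intro: continuous_on_minus)

lift_definition plus_c0 :: "('a, 'b) c0 \<Rightarrow> ('a, 'b) c0 \<Rightarrow> ('a, 'b) c0" is "\<lambda>f g x. f x + g x"
  by (auto simp: vanishing_functions_def intro: continuous_on_add tendsto_add_zero)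

lift_definition minus_c0 :: "('a, 'b) c0 \<Rightarrow> ('a, 'b) c0 \<Rightarrow> ('a, 'b) c0" is "\<lambda>f g x. f x - g x"
  using tendsto_diff[of _ 0 at_infinity _ 0]
  by (auto simp: vanishing_functions_def intro: continuous_on_diff)

lift_definition zero_c0 :: "('a, 'b) c0" is "\<lambda>_. 0"
  by (simp add: vanishing_functions_def)

lift_definition scaleR_c0 :: "real \<Rightarrow> ('a, 'b) c0 \<Rightarrow> ('a, 'b) c0" is "\<lambda>r f x. r *\<^sub>R f x"
  using tendsto_scaleR[OF tendsto_const, of _ 0 at_infinity]
  by (auto simp: vanishing_functions_def intro: continuous_on_scaleR continuous_on_const)

lemmas [simp] =
  uminus_c0.rep_eq plus_c0.rep_eq minus_c0.rep_eq zero_c0.rep_eq scaleR_c0.rep_eq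

instance
  by standard (auto intro!: c0_eqI simp: algebra_simps)

end

instantiation c0 :: (euclidean_space, real_normed_vector) real_normed_vector
begin

lift_definition norm_c0 :: "('a, 'b) c0 \<Rightarrow> real" is "\<lambda>f. SUP x. norm (f x)" .

definition dist_c0 :: "('a, 'b) c0 \<Rightarrow> ('a, 'b) c0 \<Rightarrow> real"
  where "dist_c0 f g = norm (f - g)"

definition sgn_c0 :: "('a, 'b) c0 \<Rightarrow> ('a, 'b) c0"
  where "sgn_c0 f = f /\<^sub>R norm f"

definition uniformity_c0 :: "(('a, 'b) c0 \<times> ('a, 'b) c0) filter"
  where "uniformity_c0 = (INF e\<in>{0<..}. principal {(x, y). dist x y < e})"

definition open_c0 :: "('a, 'b) c0 set \<Rightarrow> bool"
  where "open_c0 S = (\<forall>x\<in>S. \<forall>\<^sub>F (x', y) in uniformity. x' = x \<longrightarrow> y \<in> S)"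

lemma norm_apply_c0_le: "norm (apply_c0 f x) \<le> norm f"
  by transfer (auto intro: cSUP_upper vanishing_functions_bdd_above)

lemma norm_c0_least: "(\<And>x. norm (apply_c0 f x) \<le> B) \<Longrightarrow> norm f \<le> B"
  by transfer (auto intro: cSUP_least)

instance
proof
  fix a :: real and f g :: "('a, 'b) c0"
  show "norm f = 0 \<longleftrightarrow> f = 0"
  proof
    assume "norm f = 0"
    then show "f = 0"
      using norm_apply_c0_le[of f] by (auto intro!: c0_eqI)
  next
    assume "f = 0"
    then show "norm f = 0"
      using norm_c0_least[of f 0] norm_apply_c0_le[of f 0] by simp
  qed
  show "norm (f + g) \<le> norm f + norm g"
    by (rule norm_c0_least)
      (auto intro!: norm_triangle_le add_mono norm_apply_c0_le)
  have le: "norm (b *\<^sub>R h) \<le> \<bar>b\<bar> * norm h" for b and h :: "('a, 'b) c0"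
    by (rule norm_c0_least) (auto intro!: mult_left_mono norm_apply_c0_le)
  show "norm (a *\<^sub>R f) = \<bar>a\<bar> * norm f"
  proof (cases "a = 0")
    case True
    then show ?thesis
      using le[of 0 f] norm_apply_c0_le[of "0 *\<^sub>R f" 0] by simp
  next
    case False
    have "norm f \<le> \<bar>inverse a\<bar> * norm (a *\<^sub>R f)"
      using le[of "inverse a" "a *\<^sub>R f"] False by simp
    then have "\<bar>a\<bar> * norm f \<le> norm (a *\<^sub>R f)"
      using False by (simp add: field_simps abs_inverse)
    with le[of a f] show ?thesis
      by simp
  qed
qed (auto simp: dist_c0_def sgn_c0_def uniformity_c0_def open_c0_def)

end

lift_definition c0_component :: "'n::finite \<Rightarrow> ('a::euclidean_space, real^'n) c0 \<Rightarrow> ('a, real) c0"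
  is "\<lambda>i f x. f x $ i"
  using tendsto_vec_nth[of _ 0 at_infinity]
  by (auto simp: vanishing_functions_def intro: continuous_on_component)


section \<open>Smooth, compactly supported functions\<close>

primrec Ck :: "nat \<Rightarrow> ('a::euclidean_space \<Rightarrow> 'b::real_normed_vector) \<Rightarrow> bool"
  where
    "Ck 0 f \<longleftrightarrow> continuous_on UNIV f"
  | "Ck (Suc k) f \<longleftrightarrow>
       (\<forall>x. f differentiable (at x)) \<and> (\<forall>v. Ck k (\<lambda>x. frechet_derivative f (at x) v))"

definition has_compact_support :: "('a::euclidean_space \<Rightarrow> 'b::real_normed_vector) \<Rightarrow> bool"
  where "has_compact_support f \<longleftrightarrow> compact (closure {x. f x \<noteq> 0})"

text \<open>The subscript 0 in \<open>C\<^sub>0\<^sup>\<infinity>\<close> means compact support, not merely vanishing at infinity.\<close>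

definition test_function :: "('a::euclidean_space \<Rightarrow> 'b::real_normed_vector) \<Rightarrow> bool"
  where "test_function f \<longleftrightarrow> (\<forall>k. Ck k f) \<and> has_compact_support f"


section \<open>Gradient, curl and rotation in the plane\<close>

definition partial :: "'n::finite \<Rightarrow> (real^'n \<Rightarrow> real) \<Rightarrow> real^'n \<Rightarrow> real"
  where "partial j f x = frechet_derivative f (at x) (axis j 1)"

definition grad :: "(real^'n::finite \<Rightarrow> real) \<Rightarrow> real^'n \<Rightarrow> real^'n"
  where "grad f x = (\<chi> j. partial j f x)"

definition curl :: "(real^2 \<Rightarrow> real^2) \<Rightarrow> real^2 \<Rightarrow> real"
  where "curl U x = partial 1 (\<lambda>y. U y $ 2) x - partial 2 (\<lambda>y. U y $ 1) x"

definition rot90 :: "real^2 \<Rightarrow> real^2"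
  where "rot90 v = vector [- (v $ 2), v $ 1]"


section \<open>Compact support of an operator\<close>

text \<open>
  A finite signed Borel measure is represented as a difference \<open>\<mu> = M - N\<close> of two finite
  (nonnegative) Borel measures; \<open>M\<close> and \<open>N\<close> need not be mutually singular, so the support has to
  be that of the difference. A point lies outside the support iff it has an open neighbourhood all
  of whose Borel subsets are \<open>\<mu>\<close>-null.
\<close>

definition finite_borel_measure :: "'a::topological_space measure \<Rightarrow> bool"
  where "finite_borel_measure M \<longleftrightarrow> sets M = sets borel \<and> finite_measure M"

definition signed_support :: "'a::topological_space measure \<Rightarrow> 'a measure \<Rightarrow> 'a set"
  where "signed_support M N =
    {x. \<forall>W. open W \<and> x \<in> W \<longrightarrow> (\<exists>E\<in>sets borel. E \<subseteq> W \<and> measure M E \<noteq> measure N E)}"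

text \<open>
  By the Riesz representation theorem every bounded operator is given by a unique matrix of finite
  signed measures \<open>M i j - N i j\<close>, so the existential quantifiers only name that matrix; the
  content of the definition is the compactness of the supports.
\<close>

definition compactly_supported_operator ::
    "(('a::euclidean_space, real^'n::finite) c0 \<Rightarrow>\<^sub>L (real^'m::finite)) \<Rightarrow> bool"
  where "compactly_supported_operator A \<longleftrightarrow>
    (\<exists>(M :: 'm \<Rightarrow> 'n \<Rightarrow> 'a measure) (N :: 'm \<Rightarrow> 'n \<Rightarrow> 'a measure).
      (\<forall>i j. finite_borel_measure (M i j) \<and> finite_borel_measure (N i j)) \<and>
      (\<forall>U i. A U $ i =
        (\<Sum>j\<in>UNIV. (\<integral>x. U x $ j \<partial>M i j) - (\<integral>x. U x $ j \<partial>N i j))) \<and>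
      (\<forall>i j. compact (signed_support (M i j) (N i j))))"


section \<open>Test functions and their gradients vanish at infinity\<close>

text \<open>Hence \<open>C0\<close> turns them into elements of the function space, never into junk values.\<close>

lemma compact_support_vanishing:
  assumes "continuous_on UNIV f" "has_compact_support f"
  shows "f \<in> vanishing_functions"
proof -
  have "bounded (closure {x. f x \<noteq> 0})"
    using assms(2) by (simp add: has_compact_support_def compact_imp_bounded)
  then obtain B where B: "\<And>x. x \<in> closure {x. f x \<noteq> 0} \<Longrightarrow> norm x \<le> B"
    by (auto simp only: bounded_iff)
  have "f x = 0" if "B + 1 \<le> norm x" for x
  proof (rule ccontr)
    assume "f x \<noteq> 0"
    then have "x \<in> closure {x. f x \<noteq> 0}"
      by (intro subsetD[OF closure_subset]) simp
    from B[OF this] that show False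
      by simp
  qed
  then have "\<forall>\<^sub>F x in at_infinity. f x = 0"
    by (auto simp: eventually_at_infinity)
  then show ?thesis
    using assms(1) by (simp add: vanishing_functions_def tendsto_eventually)
qed

lemma test_function_vanishing:
  assumes "test_function f"
  shows "f \<in> vanishing_functions"
proof (rule compact_support_vanishing)
  have "Ck 0 f"
    using assms by (simp only: test_function_def)
  then show "continuous_on UNIV f"
    by simp
  show "has_compact_support f"
    using assms by (simp add: test_function_def)
qed

lemma grad_test_function_vanishing:
  fixes g :: "real^'n::finite \<Rightarrow> real"
  assumes "test_function g"
  shows "grad g \<in> vanishing_functions"
proof (rule compact_support_vanishing)
  let ?S = "closure {x. g x \<noteq> 0}"
  have "Ck (Suc 0) g"
    using assms by (simp only: test_function_def)
  then have "continuous_on UNIV (\<lambda>x. partial j g x)" for j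
    by (simp add: partial_def)
  then show "continuous_on UNIV (grad g)"
    unfolding grad_def by (rule continuous_on_vec_lambda)
  have "grad g x = 0" if x: "x \<in> - ?S" for x
  proof -
    have zero: "0 = g y" if "y \<in> - ?S" for y
    proof (rule ccontr)
      assume "0 \<noteq> g y"
      then have "y \<in> ?S"
        by (intro subsetD[OF closure_subset]) simp
      with that show False
        by simp
    qed
    have "open (- ?S)"
      by (rule open_Compl) (rule closed_closure)
    then have "(g has_derivative (\<lambda>_. 0)) (at x)"
      by (rule has_derivative_transform_within_open[OF has_derivative_const _ x zero])
    then have "(\<lambda>_. 0) = frechet_derivative g (at x)"
      by (rule frechet_derivative_at)
    then show ?thesis
      by (simp add: grad_def partial_def vec_eq_iff fun_eq_iff)
  qed
  then have "{x. grad g x \<noteq> 0} \<subseteq> ?S"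
    by blast
  then have "closure {x. grad g x \<noteq> 0} \<subseteq> ?S"
    by (rule closure_minimal) (rule closed_closure)
  moreover have "compact ?S"
    using assms by (simp add: test_function_def has_compact_support_def)
  ultimately show "has_compact_support (grad g)"
    unfolding has_compact_support_def
    by (metis closed_closure compact_Int_closed inf.absorb_iff2)
qed

end

theory Submission
  imports Defs
begin

text \<open>
  Let the entries of \<open>A\<close> be the compactly supported signed measures \<open>a\<close>, \<open>b\<close>, \<open>e\<close>. Annihilating gradients means
  \<open>\<partial>\<^sub>x a + \<partial>\<^sub>y b = 0\<close> and \<open>\<partial>\<^sub>x b + \<partial>\<^sub>y e = 0\<close> as distributions, so one expects \<open>a = c\<^sub>y\<^sub>y\<close>, \<open>b = - c\<^sub>x\<^sub>y\<close>, \<open>e = c\<^sub>x\<^sub>x\<close>.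
  Accordingly \<open>c z = - b {w. w \<le> z}\<close>. Testing with functions concentrated near a line shows that \<open>b\<close> has no mass on
  vertical and horizontal lines, which makes \<open>c\<close> continuous; \<open>b\<close> also vanishes on all axis-parallel half planes, which makes
  the support of \<open>c\<close> compact. Fubini's theorem gives \<open>\<integral> c \<phi>\<^sub>x\<^sub>y = - b(\<phi>)\<close>. Finally, given \<open>\<phi>\<close>, choose a test
  function \<open>g\<close> with \<open>g\<^sub>x = \<phi>\<close> near the supports; then \<open>a(\<phi>) = a(g\<^sub>x) = - b(g\<^sub>y) = \<integral> c g\<^sub>x\<^sub>y\<^sub>y = \<integral> c \<phi>\<^sub>y\<^sub>y\<close>, and
  similarly for \<open>e\<close>.
\<close>

section \<open>Closure properties of smooth functions and of test functions\<close>

section \<open>Calculus of smooth functions\<close>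

definition smooth :: "('a::euclidean_space \<Rightarrow> 'b::real_normed_vector) \<Rightarrow> bool"
  where "smooth f \<longleftrightarrow> (\<forall>k. Ck k f)"

lemma test_function_iff: "test_function f \<longleftrightarrow> smooth f \<and> has_compact_support f"
  by (simp add: test_function_def smooth_def)

lemma Ck_Suc_has_derivative:
  "Ck (Suc k) f \<Longrightarrow> (f has_derivative frechet_derivative f (at x)) (at x)"
  by (simp flip: frechet_derivative_works)

text \<open>Uniqueness of the derivative lets every later induction work with an explicit formula
  for it instead of the choice behind \<open>frechet_derivative\<close>.\<close>

lemma Ck_SucI:
  assumes "\<And>x. (f has_derivative f' x) (at x)" "\<And>v. Ck k (\<lambda>x. f' x v)"
  shows "Ck (Suc k) f"
proof -
  have "frechet_derivative f (at x) = f' x" for x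
    using frechet_derivative_at[OF assms(1)] by simp
  then show ?thesis
    using assms by (auto simp: differentiable_def)
qed

lemma Ck_continuous: "Ck k f \<Longrightarrow> continuous_on UNIV f"
  by (cases k) (simp_all add: differentiable_imp_continuous_within continuous_on_eq_continuous_within)

lemma Ck_SucD: "Ck (Suc k) f \<Longrightarrow> Ck k f"
proof (induction k arbitrary: f)
  case 0
  then show ?case
    by (simp add: Ck_continuous[of "Suc 0"] del: Ck.simps(2))
next
  case (Suc k)
  then show ?case
    by (metis Ck.simps(2))
qed

lemma Ck_const: "Ck k (\<lambda>_. c)"
proof (induction k arbitrary: c)
  case (Suc k)
  show ?case
    by (rule Ck_SucI[where f' = "\<lambda>_ _. 0"]) (use Suc in auto)
qed simp

lemma Ck_bounded_linear_compose:
  assumes "bounded_linear L"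
  shows "Ck k f \<Longrightarrow> Ck k (\<lambda>x. L (f x))"
proof (induction k arbitrary: f)
  case 0
  then show ?case
    using assms by (simp add: bounded_linear.continuous_on)
next
  case (Suc k)
  show ?case
    by (rule Ck_SucI[where f' = "\<lambda>x v. L (frechet_derivative f (at x) v)"])
      (use Suc in \<open>auto intro!: bounded_linear.has_derivative[OF assms] Ck_Suc_has_derivative[of k]\<close>)
qed

lemma Ck_bounded_linear:
  assumes "bounded_linear L"
  shows "Ck k L"
proof (cases k)
  case 0
  then show ?thesis
    using assms by (simp add: linear_continuous_on)
next
  case (Suc k')
  then show ?thesis
    using Ck_SucI[of L "\<lambda>_. L"] assms by (auto simp: Ck_const intro: bounded_linear_imp_has_derivative)
qed

lemma Ck_add: "Ck k f \<Longrightarrow> Ck k g \<Longrightarrow> Ck k (\<lambda>x. f x + g x)"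
proof (induction k arbitrary: f g)
  case 0
  then show ?case
    by (simp add: continuous_on_add)
next
  case (Suc k)
  show ?case
    by (rule Ck_SucI[where f' = "\<lambda>x v. frechet_derivative f (at x) v + frechet_derivative g (at x) v"])
      (use Suc in \<open>auto intro!: has_derivative_add Ck_Suc_has_derivative[of k]\<close>)
qed

lemma Ck_mult:
  fixes f g :: "'a::euclidean_space \<Rightarrow> real"
  shows "Ck k f \<Longrightarrow> Ck k g \<Longrightarrow> Ck k (\<lambda>x. f x * g x)"
proof (induction k arbitrary: f g)
  case 0
  then show ?case
    by (simp add: continuous_on_mult)
next
  case (Suc k)
  show ?case
    by (rule Ck_SucI[where f' = "\<lambda>x v. f x * frechet_derivative g (at x) v
          + frechet_derivative f (at x) v * g x"])
      (use Suc Ck_SucD[OF Suc.prems(1)] Ck_SucD[OF Suc.prems(2)]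
       in \<open>auto intro!: has_derivative_mult Ck_add Ck_Suc_has_derivative[of k]\<close>)
qed

lemma Ck_inverse:
  fixes f :: "'a::euclidean_space \<Rightarrow> real"
  assumes nz: "\<And>x. f x \<noteq> 0"
  shows "Ck k f \<Longrightarrow> Ck k (\<lambda>x. inverse (f x))"
proof (induction k)
  case 0
  then show ?case
    using nz by (simp add: continuous_on_inverse)
next
  case (Suc k)
  \<comment> \<open>The derivative formula below contains the reciprocal itself, whose regularity of
    order \<open>k\<close> is the induction hypothesis.\<close>
  have inv: "Ck k (\<lambda>x. inverse (f x))"
    using Suc Ck_SucD by blast
  show ?case
  proof (rule Ck_SucI)
    show "((\<lambda>x. inverse (f x)) has_derivative
        (\<lambda>v. - (inverse (f x) * frechet_derivative f (at x) v * inverse (f x)))) (at x)" for x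
      using nz by (intro Deriv.has_derivative_inverse Ck_Suc_has_derivative[OF Suc.prems])
    show "Ck k (\<lambda>x. - (inverse (f x) * frechet_derivative f (at x) v * inverse (f x)))" for v
      using Suc.prems inv
      by (intro Ck_bounded_linear_compose[OF bounded_linear_minus[OF bounded_linear_ident]] Ck_mult) auto
  qed
qed

lemma Ck_affine_compose:
  assumes "bounded_linear L"
  shows "Ck k f \<Longrightarrow> Ck k (\<lambda>x. f (L x + c))"
proof (induction k arbitrary: f)
  case 0
  then have "continuous_on UNIV (\<lambda>x. f (L x + c))"
    by (intro continuous_on_compose2[of UNIV f "UNIV" "\<lambda>x. L x + c"] continuous_on_add
        linear_continuous_on[OF assms] continuous_on_const) auto
  then show ?case
    by simp
next
  case (Suc k)
  show ?case
  proof (rule Ck_SucI)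
    show "((\<lambda>x. f (L x + c)) has_derivative (\<lambda>v. frechet_derivative f (at (L x + c)) (L v))) (at x)" for x
    proof -
      have "((\<lambda>x. L x + c) has_derivative L) (at x)"
        using has_derivative_add_const[OF bounded_linear_imp_has_derivative[OF assms]] .
      from has_derivative_compose[OF this Ck_Suc_has_derivative[OF Suc.prems]]
      show ?thesis .
    qed
    show "Ck k (\<lambda>x. frechet_derivative f (at (L x + c)) (L v))" for v
      using Suc.IH[of "\<lambda>y. frechet_derivative f (at y) (L v)"] Suc.prems by simp
  qed
qed

lemma smooth_continuous: "smooth f \<Longrightarrow> continuous_on UNIV f"
  unfolding smooth_def using Ck_continuous by blast

lemma smooth_has_derivative:
  "smooth f \<Longrightarrow> (f has_derivative frechet_derivative f (at x)) (at x)"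
  by (meson Ck_Suc_has_derivative smooth_def)

lemma smooth_frechet_derivative:
  "smooth f \<Longrightarrow> smooth (\<lambda>x. frechet_derivative f (at x) v)"
  unfolding smooth_def by (metis Ck.simps(2))

lemma smooth_const: "smooth (\<lambda>_. c)"
  by (simp add: smooth_def Ck_const)

lemma smooth_bounded_linear: "bounded_linear L \<Longrightarrow> smooth L"
  by (simp add: smooth_def Ck_bounded_linear)

lemma smooth_add: "smooth f \<Longrightarrow> smooth g \<Longrightarrow> smooth (\<lambda>x. f x + g x)"
  by (simp add: smooth_def Ck_add)

lemma smooth_mult:
  fixes f g :: "'a::euclidean_space \<Rightarrow> real"
  shows "smooth f \<Longrightarrow> smooth g \<Longrightarrow> smooth (\<lambda>x. f x * g x)"
  by (simp add: smooth_def Ck_mult)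

lemma smooth_inverse:
  fixes f :: "'a::euclidean_space \<Rightarrow> real"
  shows "smooth f \<Longrightarrow> (\<And>x. f x \<noteq> 0) \<Longrightarrow> smooth (\<lambda>x. inverse (f x))"
  by (simp add: smooth_def Ck_inverse)

lemma smooth_affine_compose:
  "smooth f \<Longrightarrow> bounded_linear L \<Longrightarrow> smooth (\<lambda>x. f (L x + c))"
  by (simp add: smooth_def Ck_affine_compose)

lemma has_compact_supportI:
  fixes f :: "'a::euclidean_space \<Rightarrow> 'b::real_normed_vector"
  assumes "\<And>x. r < norm x \<Longrightarrow> f x = 0"
  shows "has_compact_support f"
proof -
  have "{x. f x \<noteq> 0} \<subseteq> cball 0 r"
    using assms by (auto simp: not_less[symmetric])
  then show ?thesis
    unfolding has_compact_support_def
    by (meson bounded_cball bounded_subset compact_closure)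
qed

lemma has_compact_supportE:
  fixes f :: "'a::euclidean_space \<Rightarrow> 'b::real_normed_vector"
  assumes "has_compact_support f"
  obtains r where "r > 0" "\<And>x. r < norm x \<Longrightarrow> f x = 0"
proof -
  have "bounded {x. f x \<noteq> 0}"
    using assms unfolding has_compact_support_def
    by (meson bounded_subset closure_subset compact_imp_bounded)
  then obtain r where "r > 0" "\<forall>x\<in>{x. f x \<noteq> 0}. norm x \<le> r"
    unfolding bounded_pos by blast
  then show ?thesis
    by (intro that[of r]) (auto simp: not_less[symmetric])
qed

text \<open>\<open>frechet_derivative\<close> is a choice from the set of derivatives. Locally equal
  functions have the same such set, so the values agree even at points of
  non-differentiability.\<close>

lemma frechet_derivative_cong_open:
  assumes "open S" "x \<in> S" "\<And>y. y \<in> S \<Longrightarrow> f y = g y"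
  shows "frechet_derivative f (at x) = frechet_derivative g (at x)"
proof -
  have "(f has_derivative D) (at x) \<longleftrightarrow> (g has_derivative D) (at x)" for D
    using has_derivative_transform_within_open[OF _ assms(1,2)] assms(3) by metis
  then show ?thesis
    by (simp add: frechet_derivative_def)
qed

lemma has_compact_support_frechet_derivative:
  assumes "has_compact_support f"
  shows "has_compact_support (\<lambda>x. frechet_derivative f (at x) v)"
proof -
  obtain r where r: "\<And>x. r < norm x \<Longrightarrow> f x = 0"
    using assms by (rule has_compact_supportE) blast
  show ?thesis
  proof (rule has_compact_supportI)
    fix x :: 'a
    assume "r < norm x"
    moreover have "open {x::'a. r < norm x}"
      by (intro open_Collect_less continuous_intros)
    ultimately have "frechet_derivative f (at x) = frechet_derivative (\<lambda>_. 0) (at x)"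
      using r by (intro frechet_derivative_cong_open[of "{x. r < norm x}"]) auto
    then show "frechet_derivative f (at x) v = 0"
      by (simp add: frechet_derivative_const)
  qed
qed

lemma test_function_continuous: "test_function f \<Longrightarrow> continuous_on UNIV f"
  by (simp add: test_function_iff smooth_continuous)

lemma test_function_frechet_derivative:
  "test_function f \<Longrightarrow> test_function (\<lambda>x. frechet_derivative f (at x) v)"
  by (simp add: test_function_iff smooth_frechet_derivative has_compact_support_frechet_derivative)

lemma test_function_partial: "test_function f \<Longrightarrow> test_function (partial j f)"
  unfolding partial_def[abs_def] by (rule test_function_frechet_derivative)

lemma test_function_component:
  fixes U :: "'a::euclidean_space \<Rightarrow> real^'n::finite"
  assumes "test_function U"
  shows "test_function (\<lambda>x. U x $ i)"
proof -
  obtain r where "\<And>x. r < norm x \<Longrightarrow> U x = 0"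
    using assms has_compact_supportE unfolding test_function_iff by blast
  then have "has_compact_support (\<lambda>x. U x $ i)"
    by (intro has_compact_supportI[of r]) auto
  then show ?thesis
    using assms by (simp add: test_function_iff smooth_def Ck_bounded_linear_compose[OF bounded_linear_vec_nth])
qed

lemma bounded_range_compact_support:
  assumes "continuous_on UNIV f" "has_compact_support f"
  obtains C where "\<And>x. norm (f x) \<le> C"
  using vanishing_functions_bounded[OF compact_support_vanishing[OF assms]]
  by (auto simp: bounded_iff)

section \<open>A smooth transition from 0 to 1 built from exp(-1/x)\<close>

subsection \<open>A smooth step function\<close>

text \<open>Letting \<open>p\<close> range over all polynomials in 1/x makes the class closed under
  differentiation; \<open>flat 1\<close> is the classical smooth function that is not analytic at
  0.\<close>

definition flat :: "real poly \<Rightarrow> real \<Rightarrow> real"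
  where "flat p x = (if x > 0 then poly p (1 / x) * exp (- (1 / x)) else 0)"

lemma poly_times_exp_minus_tendsto_0:
  "((\<lambda>t::real. poly p t * exp (- t)) \<longlongrightarrow> 0) at_top"
proof -
  have "((\<lambda>t. \<Sum>i\<le>degree p. coeff p i * (t ^ i / exp t)) \<longlongrightarrow> (\<Sum>i\<le>degree p. coeff p i * 0)) at_top"
    by (intro tendsto_intros tendsto_power_div_exp_0)
  then show ?thesis
    by (simp add: poly_altdef sum_distrib_right exp_minus divide_inverse mult.assoc)
qed

lemma flat_tendsto_0: "(flat p \<longlongrightarrow> 0) (at_right 0)"
proof -
  have "filterlim (\<lambda>x::real. 1 / x) at_top (at_right 0)"
    using filterlim_inverse_at_top_right by (simp add: inverse_eq_divide)
  from filterlim_compose[OF poly_times_exp_minus_tendsto_0 this]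
  have "((\<lambda>x. poly p (1 / x) * exp (- (1 / x))) \<longlongrightarrow> 0) (at_right 0)" .
  moreover have "\<forall>\<^sub>F x in at_right 0. poly p (1 / x) * exp (- (1 / x)) = flat p x"
    by (auto simp: eventually_at_right_field flat_def intro: exI[of _ 1])
  ultimately show ?thesis
    by (rule Lim_transform_eventually)
qed

text \<open>With t = 1/x one has dt/dx = - t^2, so differentiation turns the factor \<open>p\<close>
  into t^2 times \<open>p - pderiv p\<close>; \<open>[:0, 0, 1:]\<close> is t^2. At the origin the
  two one-sided difference quotients are treated separately.\<close>

lemma flat_has_derivative:
  "(flat p has_real_derivative flat ([:0, 0, 1:] * (p - pderiv p)) x) (at x)"
proof -
  consider "x > 0" | "x < 0" | "x = 0"
    by linarith
  then show ?thesis
  proof cases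
    case 1
    have "((\<lambda>x. poly p (1 / x) * exp (- (1 / x))) has_real_derivative
        flat ([:0, 0, 1:] * (p - pderiv p)) x) (at x)"
      using 1
      by (auto intro!: derivative_eq_intros DERIV_chain2[OF poly_DERIV]
          simp: flat_def field_simps power2_eq_square)
    then show ?thesis
      by (rule has_field_derivative_transform_within_open[of _ _ _ "{0<..}"])
        (use 1 in \<open>auto simp: flat_def\<close>)
  next
    case 2
    have "((\<lambda>x. 0) has_real_derivative 0) (at x)"
      by simp
    then have "(flat p has_real_derivative 0) (at x)"
      by (rule has_field_derivative_transform_within_open[of _ _ _ "{..<0}"])
        (use 2 in \<open>auto simp: flat_def\<close>)
    then show ?thesis
      using 2 by (simp add: flat_def)
  next
    case 3
    \<comment> \<open>Division by h multiplies the polynomial by 1/h, so the quotient is again a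
      \<open>flat\<close> function, which tends to 0.\<close>
    have "((\<lambda>h. flat p h / h) \<longlongrightarrow> 0) (at_right 0)"
    proof (rule Lim_transform_eventually[OF flat_tendsto_0])
      show "\<forall>\<^sub>F x in at_right 0. flat ([:0, 1:] * p) x = flat p x / x"
        by (auto simp: eventually_at_right_field flat_def intro: exI[of _ 1])
    qed
    moreover have "((\<lambda>h. flat p h / h) \<longlongrightarrow> 0) (at_left 0)"
      by (rule tendsto_eventually)
        (auto simp: eventually_at_left_field flat_def intro: exI[of _ "-1"])
    ultimately have "((\<lambda>h. flat p h / h) \<longlongrightarrow> 0) (at 0)"
      by (simp add: filterlim_split_at)
    then show ?thesis
      using 3 by (simp add: DERIV_def flat_def)
  qed
qed

lemma smooth_flat: "smooth (flat p)"
proof -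
  have "Ck k (flat p)" for k
  proof (induction k arbitrary: p)
    case 0
    show ?case
      using DERIV_isCont[OF flat_has_derivative] by (simp add: continuous_on_eq_continuous_at)
  next
    case (Suc k)
    show ?case
    proof (rule Ck_SucI)
      show "(flat p has_derivative (*) (flat ([:0, 0, 1:] * (p - pderiv p)) x)) (at x)" for x
        using flat_has_derivative[of p x] by (simp only: has_field_derivative_def)
    qed (intro Ck_mult Suc Ck_const)
  qed
  then show ?thesis
    by (simp add: smooth_def)
qed

definition step :: "real \<Rightarrow> real"
  where "step x = flat 1 x * inverse (flat 1 x + flat 1 (1 - x))"

lemma flat_1_nonneg: "flat 1 x \<ge> 0" and flat_1_pos: "x > 0 \<Longrightarrow> flat 1 x > 0"
  by (simp_all add: flat_def)

text \<open>At least one of x and 1 - x is positive, so one summand is positive while the other is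
  nonnegative.\<close>

lemma step_denominator_pos: "flat 1 x + flat 1 (1 - x) > 0"
  using add_pos_nonneg[of "flat 1 x" "flat 1 (1 - x)"] add_nonneg_pos[of "flat 1 x" "flat 1 (1 - x)"]
    flat_1_nonneg flat_1_pos[of x] flat_1_pos[of "1 - x"] by force

lemma smooth_step: "smooth step"
proof -
  have "smooth (\<lambda>x. flat 1 (- x + 1))"
    by (intro smooth_affine_compose smooth_flat bounded_linear_minus bounded_linear_ident)
  then have "smooth (\<lambda>x. flat 1 (1 - x))"
    by simp
  then show ?thesis
    unfolding step_def[abs_def]
    using step_denominator_pos by (intro smooth_mult smooth_inverse smooth_add smooth_flat) (auto simp: less_imp_neq[symmetric])
qed

lemma step_eq_0: "x \<le> 0 \<Longrightarrow> step x = 0"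
  by (simp add: step_def flat_def)

lemma step_eq_1: "1 \<le> x \<Longrightarrow> step x = 1"
  using step_denominator_pos[of x] by (simp add: step_def flat_def)

lemma step_bounds: "0 \<le> step x" "step x \<le> 1"
  using step_denominator_pos[of x] flat_1_nonneg[of x] flat_1_nonneg[of "1 - x"]
  by (simp_all add: step_def field_simps)

section \<open>Compactly supported primitives in a given direction\<close>

section \<open>Primitives along a direction\<close>

text \<open>A truncated primitive: its derivative along \<open>v\<close> is f x - f (x - T v), which
  is f x wherever the shifted value vanishes. Unlike the full primitive it keeps compact support and
  so remains a test function.\<close>

definition sweep :: "real \<Rightarrow> 'a::euclidean_space \<Rightarrow> ('a \<Rightarrow> real) \<Rightarrow> 'a \<Rightarrow> real"
  where "sweep T v f x = integral {0..T} (\<lambda>s. f (x - s *\<^sub>R v))"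

text \<open>Differentiation under the integral sign. The Leibniz rule works with operator-valued
  integrands, hence the \<open>Blinfun\<close> wrapping and the return to single directions at the
  end.\<close>

lemma sweep_has_derivative:
  assumes "Ck (Suc 0) f"
  shows "(sweep T v f has_derivative (\<lambda>u. sweep T v (\<lambda>y. frechet_derivative f (at y) u) x)) (at x)"
proof -
  let ?D = "\<lambda>x s. Blinfun (frechet_derivative f (at (x - s *\<^sub>R v)))"
  have D: "(f has_derivative frechet_derivative f (at y)) (at y)" for y
    using assms by (rule Ck_Suc_has_derivative)
  have app: "blinfun_apply (?D y s) = frechet_derivative f (at (y - s *\<^sub>R v))" for y s
    by (rule bounded_linear_Blinfun_apply[OF has_derivative_bounded_linear[OF D]])
  have cont: "continuous_on UNIV (\<lambda>y. frechet_derivative f (at y) u)" for u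
    using assms by simp
  have cont': "continuous_on UNIV f"
    using assms by (rule Ck_continuous)
  \<comment> \<open>\<open>Ck\<close> provides continuity of each directional derivative separately;
    in finite dimension this is continuity in operator norm.\<close>
  have cont_D: "continuous_on (UNIV \<times> {0..T}) (\<lambda>(y, s). ?D y s)"
    unfolding split_beta
    by (intro continuous_on_blinfun_componentwise, unfold app)
      (intro continuous_on_compose2[OF cont] continuous_intros, simp)
  have "((\<lambda>y. integral (cbox 0 T) (\<lambda>s. f (y - s *\<^sub>R v))) has_derivative
      blinfun_apply (integral (cbox 0 T) (?D x))) (at x within UNIV)"
  proof (rule leibniz_rule)
    show "((\<lambda>y. f (y - s *\<^sub>R v)) has_derivative blinfun_apply (?D y s)) (at y within UNIV)" for y s
      unfolding app
      using has_derivative_compose[OF has_derivative_diff[OF has_derivative_ident has_derivative_const] D]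
      by simp
    show "(\<lambda>s. f (y - s *\<^sub>R v)) integrable_on cbox 0 T" for y
      by (intro integrable_continuous continuous_on_compose2[OF cont'] continuous_intros) auto
  qed (use cont_D in auto)
  moreover have "?D x integrable_on {0..T}"
    by (intro integrable_continuous_real continuous_on_compose2[OF cont_D, of _ "\<lambda>s. (x, s)", simplified])
      (auto intro!: continuous_intros)
  then have "blinfun_apply (integral {0..T} (?D x)) = (\<lambda>u. integral {0..T} (\<lambda>s. blinfun_apply (?D x s) u))"
    by (simp add: fun_eq_iff blinfun_apply_integral)
  ultimately show ?thesis
    by (simp add: sweep_def[abs_def] app)
qed

text \<open>One order is lost because continuity of the sweep is read off from its
  differentiability; for smooth functions this costs nothing.\<close>

lemma Ck_sweep:
  "Ck (Suc k) f \<Longrightarrow> Ck k (sweep T v f)"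
proof (induction k arbitrary: f)
  case 0
  have "isCont (sweep T v f) x" for x
    using sweep_has_derivative[OF 0] by (rule has_derivative_continuous)
  then show ?case
    by (simp add: continuous_on_eq_continuous_at)
next
  case (Suc k)
  show ?case
  proof (rule Ck_SucI)
    have "Ck (Suc 0) f"
      using Suc.prems by (auto intro: Ck_continuous[of "Suc k"])
    then show "(sweep T v f has_derivative (\<lambda>u. sweep T v (\<lambda>y. frechet_derivative f (at y) u) x)) (at x)" for x
      by (rule sweep_has_derivative)
    show "Ck k (sweep T v (\<lambda>y. frechet_derivative f (at y) u))" for u
      using Suc by simp
  qed
qed

lemma test_function_sweep:
  assumes "test_function f"
  shows "test_function (sweep T v f)"
proof -
  obtain r where r: "\<And>x. r < norm x \<Longrightarrow> f x = 0"
    using assms has_compact_supportE unfolding test_function_iff by blast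
  have "has_compact_support (sweep T v f)"
  proof (rule has_compact_supportI)
    fix x :: 'a
    assume x: "r + \<bar>T\<bar> * norm v < norm x"
    have "f (x - s *\<^sub>R v) = 0" if "s \<in> {0..T}" for s
    proof (rule r)
      have "norm (s *\<^sub>R v) \<le> \<bar>T\<bar> * norm v"
        using that by (auto intro!: mult_right_mono)
      with x norm_triangle_ineq2[of x "s *\<^sub>R v"] show "r < norm (x - s *\<^sub>R v)"
        by linarith
    qed
    then have "integral {0..T} (\<lambda>s. f (x - s *\<^sub>R v)) = integral {0..T} (\<lambda>_. 0)"
      by (rule integral_cong)
    then show "sweep T v f x = 0"
      by (simp add: sweep_def)
  qed
  moreover have "smooth (sweep T v f)"
    using assms by (simp add: test_function_iff smooth_def Ck_sweep del: Ck.simps)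
  ultimately show ?thesis
    by (simp add: test_function_iff)
qed

lemma frechet_derivative_sweep:
  "test_function f \<Longrightarrow> frechet_derivative (sweep T v f) (at x) u
    = sweep T v (\<lambda>y. frechet_derivative f (at y) u) x"
  using frechet_derivative_at[OF sweep_has_derivative] unfolding test_function_def by metis

lemma partial_sweep:
  "test_function f \<Longrightarrow> partial k (sweep T v f) = sweep T v (partial k f)"
  by (simp add: partial_def[abs_def] frechet_derivative_sweep)

text \<open>The integrand is the derivative in s of - f (x - s v), so the fundamental theorem of
  calculus leaves the two boundary values.\<close>

lemma sweep_derivative:
  assumes "smooth f" "T \<ge> 0"
  shows "sweep T v (\<lambda>y. frechet_derivative f (at y) v) x = f x - f (x - T *\<^sub>R v)"
proof -
  have "((\<lambda>s. - f (x - s *\<^sub>R v)) has_vector_derivative frechet_derivative f (at (x - s *\<^sub>R v)) v)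
      (at s within {0..T})" for s
  proof -
    have lin: "linear (frechet_derivative f (at (x - s *\<^sub>R v)))"
      using smooth_has_derivative[OF assms(1)] by (rule has_derivative_linear)
    have "((\<lambda>s. x - s *\<^sub>R v) has_derivative (\<lambda>h. - (h *\<^sub>R v))) (at s within {0..T})"
      by (auto intro!: derivative_eq_intros)
    from has_derivative_minus[OF has_derivative_compose[OF this smooth_has_derivative[OF assms(1)]]]
    show ?thesis
      by (simp add: has_vector_derivative_def linear_neg[OF lin] linear_scale[OF lin])
  qed
  from fundamental_theorem_of_calculus[OF assms(2) this]
  have "((\<lambda>s. frechet_derivative f (at (x - s *\<^sub>R v)) v) has_integral (f x - f (x - T *\<^sub>R v))) {0..T}"
    by simp
  then show ?thesis
    unfolding sweep_def by (rule integral_unique)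
qed

lemma partial_sweep_axis:
  assumes "test_function f" "T \<ge> 0"
  shows "partial k (sweep T (axis k 1) f) x = f x - f (x - T *\<^sub>R axis k 1)"
  using sweep_derivative[of f T "axis k 1" x] assms
  by (simp add: partial_sweep) (simp add: partial_def[abs_def] test_function_iff)

section \<open>Lebesgue measure in coordinates and mixed partials over quadrants\<close>

section \<open>Integration over quadrants\<close>

lemma UNIV_2_eq: "i \<noteq> j \<Longrightarrow> (UNIV :: 2 set) = {i, j}"
  using exhaust_2 by (metis (mono_tags) UNIV_2 insert_commute)

lemma forall_2_iff: "i \<noteq> j \<Longrightarrow> (\<forall>k::2. P k) \<longleftrightarrow> P i \<and> P j"
  using UNIV_2_eq[of i j] by (metis UNIV_I insert_iff singletonD)

text \<open>The two coordinates are named by arbitrary distinct indices, so that each later lemma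
  serves both orders of differentiation and both rows of the matrix.\<close>

definition plane_vec :: "2 \<Rightarrow> 2 \<Rightarrow> real \<Rightarrow> real \<Rightarrow> real^2"
  where "plane_vec i j x y = x *\<^sub>R axis i 1 + y *\<^sub>R axis j 1"

lemma plane_vec_nth [simp]:
  "i \<noteq> j \<Longrightarrow> plane_vec i j x y $ i = x" "i \<noteq> j \<Longrightarrow> plane_vec i j x y $ j = y"
  by (simp_all add: plane_vec_def axis_def)

lemma plane_vec_eta: "i \<noteq> j \<Longrightarrow> plane_vec i j (z $ i) (z $ j) = z"
  by (simp add: vec_eq_iff forall_2_iff[of i j])

lemma plane_vec_measurable [measurable]:
  "(\<lambda>(y, x). plane_vec i j x y) \<in> borel_measurable (lborel \<Otimes>\<^sub>M lborel)"
proof -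
  have "continuous_on UNIV (\<lambda>(y, x). plane_vec i j x y)"
    unfolding plane_vec_def split_beta by (intro continuous_intros)
  then show ?thesis
    by (simp add: borel_prod lborel_prod borel_measurable_continuous_onI)
qed

text \<open>Lebesgue measure is determined by its values on boxes, and the preimage of a box is a
  product of two intervals. Putting y first makes x the inner variable of the iterated
  integral.\<close>

lemma lborel_plane:
  assumes "i \<noteq> j"
  shows "distr (lborel \<Otimes>\<^sub>M lborel) borel (\<lambda>(y, x). plane_vec i j x y) = lborel"
proof (rule lborel_eqI[symmetric])
  fix l u :: "real^2"
  assume lu: "\<And>b. b \<in> Basis \<Longrightarrow> l \<bullet> b \<le> u \<bullet> b"
  have le: "l $ k \<le> u $ k" for k
    using lu[of "axis k 1"] by (simp add: inner_axis axis_in_Basis_iff)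
  have "(\<lambda>(y, x). plane_vec i j x y) -` box l u \<inter> space (lborel \<Otimes>\<^sub>M lborel)
      = {l $ j<..<u $ j} \<times> {l $ i<..<u $ i}"
    using assms by (auto simp: mem_box_cart forall_2_iff[of i j] space_pair_measure)
  then have "emeasure (distr (lborel \<Otimes>\<^sub>M lborel) borel (\<lambda>(y, x). plane_vec i j x y)) (box l u)
      = emeasure (lborel \<Otimes>\<^sub>M lborel) ({l $ j<..<u $ j} \<times> {l $ i<..<u $ i})"
    by (simp add: emeasure_distr)
  also have "\<dots> = ennreal (u $ j - l $ j) * ennreal (u $ i - l $ i)"
    using le by (simp add: lborel.emeasure_pair_measure_Times)
  also have "\<dots> = ennreal ((u $ i - l $ i) * (u $ j - l $ j))"
    using le by (simp add: ennreal_mult' mult.commute)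
  also have "(u $ i - l $ i) * (u $ j - l $ j) = (\<Prod>b\<in>Basis. (u - l) \<bullet> b)"
  proof -
    have basis: "(Basis :: (real^2) set) = {axis i 1, axis j 1}"
      by (auto simp: Basis_vec_def UNIV_2_eq[OF assms])
    have "axis i 1 \<noteq> (axis j 1 :: real^2)"
      using assms by (simp add: axis_eq_axis)
    then show ?thesis
      unfolding basis by (simp add: inner_axis)
  qed
  finally show "emeasure (distr (lborel \<Otimes>\<^sub>M lborel) borel (\<lambda>(y, x). plane_vec i j x y)) (box l u)
      = ennreal (\<Prod>b\<in>Basis. (u - l) \<bullet> b)" .
qed simp

text \<open>The mass of \<open>quadrant z\<close>, as a function of the corner \<open>z\<close>, is
  the two-dimensional distribution function of a measure.\<close>

definition quadrant :: "real^2 \<Rightarrow> (real^2) set"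
  where "quadrant z = {w. \<forall>k. w $ k \<le> z $ k}"

lemma closed_quadrant: "closed (quadrant z)"
  unfolding quadrant_def by (intro closed_Collect_all closed_Collect_le continuous_intros)

lemma quadrant_measurable [measurable]: "quadrant z \<in> sets borel"
  using closed_quadrant by (rule borel_closed)

text \<open>Joint measurability in point and corner is what Fubini's theorem will need.\<close>

lemma indicator_quadrant_pair_measurable:
  "(\<lambda>p. indicator (quadrant (snd p)) (fst p) :: real) \<in> borel_measurable borel"
proof -
  have "closed {p :: (real^2) \<times> (real^2). \<forall>k. fst p $ k \<le> snd p $ k}"
    by (intro closed_Collect_all closed_Collect_le continuous_intros)
  then have "(indicator {p :: (real^2) \<times> (real^2). \<forall>k. fst p $ k \<le> snd p $ k} :: _ \<Rightarrow> real)
      \<in> borel_measurable borel"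
    by (intro borel_measurable_indicator borel_closed)
  moreover have "(\<lambda>p. indicator (quadrant (snd p)) (fst p) :: real)
      = indicator {p. \<forall>k. fst p $ k \<le> snd p $ k}"
    by (auto simp: fun_eq_iff quadrant_def indicator_def)
  ultimately show ?thesis
    by simp
qed

lemma integrable_compact_support:
  fixes f :: "'a::euclidean_space \<Rightarrow> 'b::{banach, second_countable_topology}"
  assumes "continuous_on UNIV f" "has_compact_support f"
  shows "integrable lborel f"
proof -
  obtain r where r: "\<And>x. r < norm x \<Longrightarrow> f x = 0"
    using assms(2) by (rule has_compact_supportE) blast
  have "integrable lborel (\<lambda>x. indicator (cball 0 r) x *\<^sub>R f x)"
    by (intro borel_integrable_compact continuous_on_subset[OF assms(1)]) auto
  moreover have "(\<lambda>x. indicator (cball 0 r) x *\<^sub>R f x) = f"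
    using r by (auto simp: fun_eq_iff indicator_def not_le)
  ultimately show ?thesis
    by simp
qed

lemma integral_derivative_atLeast:
  fixes f f' :: "real \<Rightarrow> real"
  assumes "\<And>x. (f has_real_derivative f' x) (at x)" "continuous_on UNIV f'"
    "\<And>x. r < x \<Longrightarrow> f x = 0"
  shows "(\<integral>x. indicator {a..} x * f' x \<partial>lborel) = - f a"
proof -
  \<comment> \<open>The endpoint lies at or beyond \<open>a\<close> and strictly beyond
    \<open>r\<close>, so the function vanishes there and its derivative vanishes from there
    on.\<close>
  define b where "b = max a (r + 1)"
  have f'0: "f' x = 0" if "r < x" for x
  proof -
    have "(f has_real_derivative 0) (at x)"
      by (rule has_field_derivative_transform_within_open[of "\<lambda>_. 0" _ _ "{r<..}"])
        (use that assms(3) in auto)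
    then show ?thesis
      using assms(1) DERIV_unique by blast
  qed
  have "(\<integral>x. indicator {a..} x * f' x \<partial>lborel) = (\<integral>x. f' x * indicator {a..b} x \<partial>lborel)"
    using f'0 by (intro Bochner_Integration.integral_cong) (auto simp: indicator_def b_def)
  also have "\<dots> = f b - f a"
    using assms(1,2)
    by (intro integral_FTC_Icc_real) (auto simp: b_def continuous_on_eq_continuous_at)
  also have "f b = 0"
    using assms(3) by (simp add: b_def)
  finally show ?thesis
    by simp
qed

lemma plane_vec_has_derivative:
  assumes "smooth f"
  shows "((\<lambda>x. f (plane_vec i j x y)) has_real_derivative partial i f (plane_vec i j x y)) (at x)"
    "((\<lambda>y. f (plane_vec i j x y)) has_real_derivative partial j f (plane_vec i j x y)) (at y)"
proof -
  have lin: "linear (frechet_derivative f (at z))" for z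
    using smooth_has_derivative[OF assms] by (rule has_derivative_linear)
  have "((\<lambda>x. plane_vec i j x y) has_derivative (\<lambda>h. h *\<^sub>R axis i 1)) (at x)"
    "((\<lambda>y. plane_vec i j x y) has_derivative (\<lambda>h. h *\<^sub>R axis j 1)) (at y)"
    unfolding plane_vec_def by (auto intro!: derivative_eq_intros)
  from this[THEN has_derivative_compose[OF _ smooth_has_derivative[OF assms]]]
  show "((\<lambda>x. f (plane_vec i j x y)) has_real_derivative partial i f (plane_vec i j x y)) (at x)"
    "((\<lambda>y. f (plane_vec i j x y)) has_real_derivative partial j f (plane_vec i j x y)) (at y)"
    by (simp_all add: has_field_derivative_def partial_def linear_scale[OF lin] mult_commute_abs)
qed

lemma continuous_on_plane_vec:
  assumes "continuous_on UNIV f"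
  shows "continuous_on UNIV (\<lambda>x. f (plane_vec i j x y))" "continuous_on UNIV (\<lambda>y. f (plane_vec i j x y))"
  by (intro continuous_on_compose2[OF assms], auto simp: plane_vec_def intro!: continuous_intros)+

text \<open>The corners \<open>z\<close> whose quadrant contains \<open>w\<close> form the upper
  right quadrant at \<open>w\<close>. Integrating over it, first in coordinate \<open>i\<close> and
  then in \<open>j\<close>, evaluates at the lower endpoints; each integration contributes a minus
  sign, and the two cancel.\<close>

lemma integral_quadrant_mixed_partial:
  fixes f :: "real^2 \<Rightarrow> real"
  assumes "test_function f" "i \<noteq> j"
  shows "(\<integral>z. indicator (quadrant z) w * partial i (partial j f) z \<partial>lborel) = f w"
proof -
  let ?h = "\<lambda>z. indicator (quadrant z) w * partial i (partial j f) z"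
  have test: "test_function (partial j f)" "test_function (partial i (partial j f))"
    using assms(1) by (auto intro: test_function_partial)
  obtain r where r: "r > 0" "\<And>z. r < norm z \<Longrightarrow> f z = 0"
    using assms(1) unfolding test_function_iff by (auto elim: has_compact_supportE)
  obtain r' where r': "r' > 0" "\<And>z. r' < norm z \<Longrightarrow> partial j f z = 0"
    using test(1) unfolding test_function_iff by (auto elim: has_compact_supportE)
  have far: "s < norm (plane_vec i j x y)" if "s < x \<or> s < y" for x y s
    using that component_le_norm_cart[of "plane_vec i j x y" i]
      component_le_norm_cart[of "plane_vec i j x y" j] assms(2) by auto
  have ind: "indicator (quadrant z) w = (indicator {z. \<forall>k. w $ k \<le> z $ k} z :: real)" for z
    by (auto simp: quadrant_def indicator_def)
  have "closed {z :: real^2. \<forall>k. w $ k \<le> z $ k}"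
    by (intro closed_Collect_all closed_Collect_le continuous_intros)
  then have meas: "{z :: real^2. \<forall>k. w $ k \<le> z $ k} \<in> sets borel"
    by (rule borel_closed)
  have "integrable lborel (partial i (partial j f))"
    using test(2) by (intro integrable_compact_support) (auto simp: test_function_iff smooth_continuous)
  then have int: "integrable lborel ?h"
    unfolding ind using meas by (simp add: mult.commute integrable_real_mult_indicator)
  have meas_h: "?h \<in> borel_measurable borel"
    using borel_measurable_integrable[OF int] by (simp only: measurable_lborel2)
  let ?T = "\<lambda>(y, x). plane_vec i j x y"
  have "integrable (lborel \<Otimes>\<^sub>M lborel) (\<lambda>p. ?h (?T p))"
    using int by (subst (asm) lborel_plane[OF assms(2), symmetric])
      (subst (asm) integrable_distr_eq, use meas_h in auto)
  note int' = this
  have "(\<integral>z. ?h z \<partial>lborel) = (\<integral>p. ?h (?T p) \<partial>(lborel \<Otimes>\<^sub>M lborel))"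
    using meas_h by (subst lborel_plane[OF assms(2), symmetric], subst integral_distr) auto
  also have "\<dots> = (\<integral>y. (\<integral>x. ?h (plane_vec i j x y) \<partial>lborel) \<partial>lborel)"
    using lborel_pair.integral_fst'[OF int'] by simp
  also have "\<dots> = (\<integral>y. - (indicator {w $ j..} y * partial j f (plane_vec i j (w $ i) y)) \<partial>lborel)"
  proof (intro Bochner_Integration.integral_cong refl)
    fix y
    have "(\<integral>x. ?h (plane_vec i j x y) \<partial>lborel) = (\<integral>x. indicator {w $ j..} y *
        (indicator {w $ i..} x * partial i (partial j f) (plane_vec i j x y)) \<partial>lborel)"
      using assms(2) by (intro Bochner_Integration.integral_cong)
        (auto simp: quadrant_def indicator_def forall_2_iff[of i j])
    also have "\<dots> = indicator {w $ j..} y * - partial j f (plane_vec i j (w $ i) y)"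
      using test far r'(2) by (subst Bochner_Integration.integral_mult_right_zero,
        subst integral_derivative_atLeast[of "\<lambda>x. partial j f (plane_vec i j x y)" _ r'])
        (auto simp: test_function_iff smooth_continuous intro!: plane_vec_has_derivative continuous_on_plane_vec)
    finally show "(\<integral>x. ?h (plane_vec i j x y) \<partial>lborel)
        = - (indicator {w $ j..} y * partial j f (plane_vec i j (w $ i) y))"
      by simp
  qed
  also have "\<dots> = f (plane_vec i j (w $ i) (w $ j))"
    using test assms(1) far r(2) by (subst Bochner_Integration.integral_minus,
      subst integral_derivative_atLeast[of "\<lambda>y. f (plane_vec i j (w $ i) y)" _ r])
      (auto simp: test_function_iff smooth_continuous intro!: plane_vec_has_derivative continuous_on_plane_vec)
  finally show ?thesis
    by (simp add: plane_vec_eta[OF assms(2)])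
qed

section \<open>Signed measures as differences of finite Borel measures\<close>

section \<open>Signed measures in the plane\<close>

definition signed_integral :: "'a measure \<Rightarrow> 'a measure \<Rightarrow> ('a \<Rightarrow> real) \<Rightarrow> real"
  where "signed_integral M N f = (\<integral>x. f x \<partial>M) - (\<integral>x. f x \<partial>N)"

lemma measurable_finite_borel: "finite_borel_measure M \<Longrightarrow> measurable M S = measurable borel S"
  by (rule measurable_cong_sets) (simp_all add: finite_borel_measure_def)

lemma integrable_bounded_borel:
  fixes f :: "'a::topological_space \<Rightarrow> real"
  assumes "finite_borel_measure M" "f \<in> borel_measurable borel" "\<And>x. \<bar>f x\<bar> \<le> C"
  shows "integrable M f"
proof -
  interpret finite_measure M
    using assms(1) by (simp add: finite_borel_measure_def)
  have "f \<in> borel_measurable M"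
    using assms(1,2) by (simp add: measurable_finite_borel)
  then show ?thesis
    using assms(3) by (intro integrable_const_bound[of f C]) auto
qed

text \<open>The complement of the support is a union of open sets on all of whose Borel subsets the
  measures agree. By Lindelof countably many of them suffice; cutting \<open>E\<close> along a
  disjointed version of this cover and using countable additivity gives equality on
  \<open>E\<close>.\<close>

lemma measure_eq_outside_signed_support:
  fixes M N :: "'a::second_countable_topology measure"
  assumes "finite_borel_measure M" "finite_borel_measure N"
    and E: "E \<in> sets borel" "E \<inter> signed_support M N = {}"
  shows "measure M E = measure N E"
proof (cases "E = {}")
  case False
  interpret M: finite_measure M
    using assms(1) by (simp add: finite_borel_measure_def)
  interpret N: finite_measure N
    using assms(2) by (simp add: finite_borel_measure_def)
  have sets: "sets M = sets borel" "sets N = sets borel"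
    using assms(1,2) by (simp_all add: finite_borel_measure_def)
  define \<F> where "\<F> = {W. open W \<and> (\<forall>E\<in>sets borel. E \<subseteq> W \<longrightarrow> measure M E = measure N E)}"
  obtain \<F>' where \<F>': "\<F>' \<subseteq> \<F>" "countable \<F>'" "\<Union>\<F>' = \<Union>\<F>"
    using Lindelof[of \<F>] by (auto simp: \<F>_def)
  have "E \<subseteq> \<Union>\<F>"
  proof
    fix x assume "x \<in> E"
    then have "x \<notin> signed_support M N"
      using E(2) by blast
    then obtain W where "open W" "x \<in> W" "\<forall>E\<in>sets borel. E \<subseteq> W \<longrightarrow> measure M E = measure N E"
      unfolding signed_support_def by blast
    then show "x \<in> \<Union>\<F>"
      unfolding \<F>_def by blast
  qed
  then have cover: "E \<subseteq> \<Union>\<F>'" "\<F>' \<noteq> {}"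
    using \<F>'(3) False by auto
  define W where "W = from_nat_into \<F>'"
  have W: "range W = \<F>'"
    using cover(2) \<F>'(2) by (simp add: W_def range_from_nat_into)
  have W_open: "open (W n)" and W_eq: "\<And>E. E \<in> sets borel \<Longrightarrow> E \<subseteq> W n \<Longrightarrow> measure M E = measure N E" for n
    using W \<F>'(1) by (auto simp: \<F>_def)
  define A where "A n = E \<inter> disjointed W n" for n
  have A_sets: "A n \<in> sets borel" for n
  proof -
    have "range (disjointed W) \<subseteq> sets borel"
      using W_open by (intro sets.range_disjointed_sets) auto
    then show ?thesis
      unfolding A_def using E(1) by (intro sets.Int) auto
  qed
  have A_disj: "disjoint_family A"
    unfolding A_def by (rule disjoint_family_on_bisimulation[OF disjoint_family_disjointed[of W]]) blast
  have A_Un: "(\<Union>n. A n) = E"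
    using cover(1) W UN_disjointed_eq[of W] by (auto simp: A_def)
  have "measure M (A n) = measure N (A n)" for n
    using A_sets disjointed_subset[of W n] by (intro W_eq[of _ n]) (auto simp: A_def)
  moreover have "(\<lambda>n. measure M (A n)) sums measure M E" "(\<lambda>n. measure N (A n)) sums measure N E"
    using M.finite_measure_UNION[of A] N.finite_measure_UNION[of A] A_sets A_disj A_Un by (auto simp: sets)
  ultimately show ?thesis
    by (simp add: sums_unique2)
qed simp

text \<open>A density rather than a restricted space keeps all Borel sets of the whole space
  measurable, so the result is again a finite Borel measure there.\<close>

definition restrict_measure :: "'a measure \<Rightarrow> 'a set \<Rightarrow> 'a measure"
  where "restrict_measure M K = density M (indicator K)"

lemma finite_borel_restrict_measure:
  assumes "finite_borel_measure M" "K \<in> sets borel"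
  shows "finite_borel_measure (restrict_measure M K)"
proof -
  interpret finite_measure M
    using assms(1) by (simp add: finite_borel_measure_def)
  have "finite_measure (density M (indicator K))"
    using assms by (intro finite_measure_restricted) (simp add: finite_borel_measure_def)
  then show ?thesis
    using assms(1) by (simp add: restrict_measure_def finite_borel_measure_def)
qed

lemma AE_restrict_measure:
  assumes "finite_borel_measure M" "K \<in> sets borel"
  shows "AE x in restrict_measure M K. x \<in> K"
proof -
  have "K \<in> sets M"
    using assms by (simp add: finite_borel_measure_def)
  then show ?thesis
    unfolding restrict_measure_def by (subst AE_density) (auto simp: indicator_def split: if_splits)
qed

lemma integral_restrict_measure:
  fixes f :: "'a::topological_space \<Rightarrow> real"
  assumes "finite_borel_measure M" "K \<in> sets borel" "f \<in> borel_measurable borel"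
  shows "(\<integral>x. f x \<partial>restrict_measure M K) = (\<integral>x. indicator K x * f x \<partial>M)"
proof -
  have "K \<in> sets M" "f \<in> borel_measurable M"
    using assms by (simp_all add: measurable_finite_borel) (simp add: finite_borel_measure_def)
  moreover have "restrict_measure M K = density M (\<lambda>x. ennreal (indicator K x))"
    by (simp add: restrict_measure_def ennreal_indicator)
  ultimately show ?thesis
    by (simp add: integral_density)
qed

text \<open>Compact support constrains the difference only: each of \<open>M\<close> and
  \<open>N\<close> may have mass far away. That mass is common to both, so cutting both down to
  \<open>K\<close> preserves signed integrals.\<close>

lemma signed_integral_restrict_measure:
  fixes f :: "'a::second_countable_topology \<Rightarrow> real"
  assumes fin: "finite_borel_measure M" "finite_borel_measure N"
    and K: "K \<in> sets borel" "signed_support M N \<subseteq> K"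
    and f: "f \<in> borel_measurable borel" "\<And>x. \<bar>f x\<bar> \<le> C"
  shows "signed_integral (restrict_measure M K) (restrict_measure N K) f = signed_integral M N f"
proof -
  have split: "(\<integral>x. f x \<partial>L) = (\<integral>x. f x \<partial>restrict_measure L K) + (\<integral>x. f x \<partial>restrict_measure L (- K))"
    if L: "finite_borel_measure L" for L
  proof -
    have "integrable L (\<lambda>x. indicator S x * f x)" if "S \<in> sets borel" for S
    proof (rule integrable_bounded_borel[OF L])
      show "\<bar>indicator S x * f x\<bar> \<le> C" for x
        using f(2)[of x] order_trans[OF abs_ge_zero f(2)[of x]] by (simp add: indicator_def)
    qed (intro borel_measurable_times f(1) borel_measurable_indicator that)
    then have "(\<integral>x. indicator K x * f x \<partial>L) + (\<integral>x. indicator (- K) x * f x \<partial>L)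
        = (\<integral>x. indicator K x * f x + indicator (- K) x * f x \<partial>L)"
      using K(1) by (intro Bochner_Integration.integral_add[symmetric]) auto
    also have "\<dots> = (\<integral>x. f x \<partial>L)"
      by (intro Bochner_Integration.integral_cong) (auto simp: indicator_def)
    finally show ?thesis
      using K(1) f(1) L by (simp add: integral_restrict_measure)
  qed
  have sets: "sets M = sets borel" "sets N = sets borel"
    using fin by (simp_all add: finite_borel_measure_def)
  \<comment> \<open>Outside \<open>K\<close> the measures coincide, so the second summands in
    \<open>split\<close> cancel in the difference.\<close>
  have "restrict_measure M (- K) = restrict_measure N (- K)"
  proof (rule measure_eqI)
    fix E assume "E \<in> sets (restrict_measure M (- K))"
    then have E: "E \<in> sets borel"
      by (simp add: restrict_measure_def sets)
    interpret M: finite_measure M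
      using fin(1) by (simp add: finite_borel_measure_def)
    interpret N: finite_measure N
      using fin(2) by (simp add: finite_borel_measure_def)
    have "measure M (- K \<inter> E) = measure N (- K \<inter> E)"
      using E K by (intro measure_eq_outside_signed_support fin) auto
    then have "emeasure M (- K \<inter> E) = emeasure N (- K \<inter> E)"
      by (simp add: M.emeasure_eq_measure N.emeasure_eq_measure)
    moreover have "- K \<in> sets borel"
      using K(1) by auto
    ultimately show "emeasure (restrict_measure M (- K)) E = emeasure (restrict_measure N (- K)) E"
      using E by (simp add: restrict_measure_def emeasure_restricted sets)
  qed (simp add: restrict_measure_def sets)
  then show ?thesis
    using split[OF fin(1)] split[OF fin(2)] by (simp add: signed_integral_def)
qed

text \<open>Both measures, and not just their difference, live on the box of radius
  \<open>R\<close>; hence integrands may be altered outside it and limits need only be checked on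
  it.\<close>

locale planar_signed_measure =
  fixes R :: real and M N :: "(real^2) measure"
  assumes R_nonneg: "R \<ge> 0"
    and finite_borel: "finite_borel_measure M" "finite_borel_measure N"
    and box: "AE x in M. \<forall>k. \<bar>x $ k\<bar> \<le> R" "AE x in N. \<forall>k. \<bar>x $ k\<bar> \<le> R"
begin

sublocale M: finite_measure M
  using finite_borel by (simp add: finite_borel_measure_def)

sublocale N: finite_measure N
  using finite_borel by (simp add: finite_borel_measure_def)

lemma sets_eq [measurable_cong]: "sets M = sets borel" "sets N = sets borel"
  using finite_borel by (simp_all add: finite_borel_measure_def)

lemma measurable_eq: "measurable M S = measurable borel S" "measurable N S = measurable borel S"
  by (simp_all add: measurable_finite_borel finite_borel)

abbreviation "\<I> f \<equiv> signed_integral M N f"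

lemma cong:
  assumes "f \<in> borel_measurable borel" "g \<in> borel_measurable borel"
    and eq: "\<And>x. (\<And>k. \<bar>x $ k\<bar> \<le> R) \<Longrightarrow> f x = g x"
  shows "\<I> f = \<I> g"
proof -
  have "(\<integral>x. f x \<partial>M) = (\<integral>x. g x \<partial>M)" "(\<integral>x. f x \<partial>N) = (\<integral>x. g x \<partial>N)"
    using box assms(1,2) by (auto intro!: integral_cong_AE eq elim!: eventually_mono simp: measurable_eq)
  then show ?thesis
    by (simp add: signed_integral_def)
qed

lemma add:
  assumes "f \<in> borel_measurable borel" "\<And>x. \<bar>f x\<bar> \<le> C"
    and "g \<in> borel_measurable borel" "\<And>x. \<bar>g x\<bar> \<le> D"
  shows "\<I> (\<lambda>x. f x + g x) = \<I> f + \<I> g"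
  using integrable_bounded_borel[OF finite_borel(1) assms(1,2)] integrable_bounded_borel[OF finite_borel(2) assms(1,2)]
    integrable_bounded_borel[OF finite_borel(1) assms(3,4)] integrable_bounded_borel[OF finite_borel(2) assms(3,4)]
  by (simp add: signed_integral_def)

lemma minus: "\<I> (\<lambda>x. - f x) = - \<I> f"
  by (simp add: signed_integral_def)

lemma diff:
  assumes "f \<in> borel_measurable borel" "\<And>x. \<bar>f x\<bar> \<le> C"
    and "g \<in> borel_measurable borel" "\<And>x. \<bar>g x\<bar> \<le> D"
  shows "\<I> (\<lambda>x. f x - g x) = \<I> f - \<I> g"
  using add[of f C "\<lambda>x. - g x" D] assms by (simp add: minus)

lemma zero: "\<I> (\<lambda>_. 0) = 0"
  by (simp add: signed_integral_def)

text \<open>Dominated convergence: constants are integrable for finite measures, so a uniform bound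
  dominates.\<close>

lemma tendsto:
  assumes "\<And>n. f n \<in> borel_measurable borel" "g \<in> borel_measurable borel"
    and bound: "\<And>n x. \<bar>f n x\<bar> \<le> C"
    and lim: "\<And>x. (\<And>k. \<bar>x $ k\<bar> \<le> R) \<Longrightarrow> (\<lambda>n. f n x) \<longlonglongrightarrow> g x"
  shows "(\<lambda>n. \<I> (f n)) \<longlonglongrightarrow> \<I> g"
proof -
  have "(\<lambda>n. \<integral>x. f n x \<partial>M) \<longlonglongrightarrow> (\<integral>x. g x \<partial>M)"
    using assms(1,2) box(1) bound
    by (intro integral_dominated_convergence[where w = "\<lambda>_. C"])
      (auto intro!: lim elim!: eventually_mono simp: measurable_eq)
  moreover have "(\<lambda>n. \<integral>x. f n x \<partial>N) \<longlonglongrightarrow> (\<integral>x. g x \<partial>N)"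
    using assms(1,2) box(2) bound
    by (intro integral_dominated_convergence[where w = "\<lambda>_. C"])
      (auto intro!: lim elim!: eventually_mono simp: measurable_eq)
  ultimately show ?thesis
    unfolding signed_integral_def by (rule tendsto_diff)
qed

text \<open>The mixed derivative of a distribution function is the measure itself, in weak form:
  swap the integrals by Fubini and apply \<open>integral_quadrant_mixed_partial\<close> for each
  fixed point.\<close>

lemma quadrant_measure_mixed_partial:
  assumes f: "test_function f" and ij: "i \<noteq> j"
  shows "(\<integral>z. \<I> (indicator (quadrant z)) * partial i (partial j f) z \<partial>lborel) = \<I> f"
proof -
  let ?h = "partial i (partial j f)"
  have test: "test_function ?h"
    using f by (intro test_function_partial)
  then have cont: "continuous_on UNIV ?h" and supp: "has_compact_support ?h"
    by (simp_all add: test_function_continuous test_function_iff)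
  have int_h: "integrable lborel ?h"
    using cont supp by (rule integrable_compact_support)
  \<comment> \<open>The identity is shown for one nonnegative measure at a time; integrability is
    carried along so that the two instances can be subtracted.\<close>
  have part: "integrable lborel (\<lambda>z. (\<integral>w. indicator (quadrant z) w \<partial>L) * ?h z)
      \<and> (\<integral>z. (\<integral>w. indicator (quadrant z) w \<partial>L) * ?h z \<partial>lborel) = (\<integral>w. f w \<partial>L)"
    if L: "finite_borel_measure L" for L
  proof -
    interpret L: finite_measure L
      using L by (simp add: finite_borel_measure_def)
    interpret pair_sigma_finite L lborel ..
    have [measurable_cong]: "sets L = sets borel"
      using L by (simp add: finite_borel_measure_def)
    have sets_pair: "sets (L \<Otimes>\<^sub>M lborel) = sets (borel :: ((real^2) \<times> (real^2)) measure)"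
      by (metis \<open>sets L = sets borel\<close> borel_prod sets_lborel sets_pair_measure_cong)
    have meas: "(\<lambda>p. indicator (quadrant (snd p)) (fst p) * ?h (snd p)) \<in> borel_measurable (L \<Otimes>\<^sub>M lborel)"
      unfolding measurable_cong_sets[OF sets_pair refl]
      by (intro borel_measurable_times indicator_quadrant_pair_measurable borel_measurable_continuous_onI
          continuous_on_compose2[OF cont] continuous_intros) auto
    have int_w: "integrable lborel (\<lambda>z. indicator (quadrant z) w * ?h z)" for w
    proof (rule Bochner_Integration.integrable_bound[OF int_h])
      show "(\<lambda>z. indicator (quadrant z) w * ?h z) \<in> borel_measurable lborel"
        using measurable_compose[OF measurable_Pair1' meas, of w] \<open>sets L = sets borel\<close>
        by (simp add: sets_eq_imp_space_eq[OF \<open>sets L = sets borel\<close>])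
    qed (auto simp: indicator_def)
    \<comment> \<open>The inner integral of the absolute value is at most the L1 norm of
      \<open>?h\<close>, a constant, which is integrable for a finite measure.\<close>
    have int: "integrable (L \<Otimes>\<^sub>M lborel) (\<lambda>(w, z). indicator (quadrant z) w * ?h z)"
    proof (rule Fubini_integrable)
      show meas': "(\<lambda>(w, z). indicator (quadrant z) w * ?h z) \<in> borel_measurable (L \<Otimes>\<^sub>M lborel)"
        using meas by (simp add: split_beta)
      show "integrable L (\<lambda>w. \<integral>z. norm (case (w, z) of (w, z) \<Rightarrow> indicator (quadrant z) w * ?h z) \<partial>lborel)"
      proof (rule L.integrable_const_bound)
        show "AE w in L. norm (\<integral>z. norm (case (w, z) of (w, z) \<Rightarrow> indicator (quadrant z) w * ?h z) \<partial>lborel)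
            \<le> (\<integral>z. norm (?h z) \<partial>lborel)"
          using int_w int_h
          by (intro always_eventually allI)
            (auto intro!: integral_mono integrable_norm simp: indicator_def integral_nonneg_AE)
        show "(\<lambda>w. \<integral>z. norm (case (w, z) of (w, z) \<Rightarrow> indicator (quadrant z) w * ?h z) \<partial>lborel)
            \<in> borel_measurable L"
          by (intro lborel.borel_measurable_lebesgue_integral)
            (use measurable_compose[OF meas' borel_measurable_norm] in \<open>simp add: split_beta\<close>)
      qed
    qed (use int_w in simp)
    have "integrable lborel (\<lambda>z. \<integral>w. indicator (quadrant z) w * ?h z \<partial>L)"
      using int by (rule integrable_snd)
    moreover have "(\<integral>z. (\<integral>w. indicator (quadrant z) w * ?h z \<partial>L) \<partial>lborel)
        = (\<integral>w. (\<integral>z. indicator (quadrant z) w * ?h z \<partial>lborel) \<partial>L)"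
      using int by (rule Fubini_integral)
    ultimately show ?thesis
      using integral_quadrant_mixed_partial[OF f ij] by simp
  qed
  show ?thesis
    using part[OF finite_borel(1)] part[OF finite_borel(2)]
    by (simp add: signed_integral_def left_diff_distrib)
qed

end

section \<open>Test functions in product form and their partial derivatives\<close>

section \<open>Products of smooth functions of one variable\<close>

lemma smooth_has_real_derivative:
  fixes u :: "real \<Rightarrow> real"
  assumes "smooth u"
  shows "(u has_real_derivative deriv u t) (at t)"
  using smooth_has_derivative[OF assms, of t] DERIV_deriv_iff_real_differentiable differentiable_def
  by blast

lemma continuous_on_deriv:
  fixes u :: "real \<Rightarrow> real"
  assumes "smooth u"
  shows "continuous_on UNIV (deriv u)"
proof -
  have "deriv u t = frechet_derivative u (at t) 1" for t
    using frechet_derivative_at[OF smooth_has_real_derivative[OF assms, of t, unfolded has_field_derivative_def]]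
    by (metis mult.right_neutral)
  then have "deriv u = (\<lambda>t. frechet_derivative u (at t) 1)"
    by blast
  then show ?thesis
    using smooth_continuous[OF smooth_frechet_derivative[OF assms, of 1]] by simp
qed

lemma deriv_eq_0_open:
  fixes u :: "real \<Rightarrow> real"
  assumes "open S" "t \<in> S" "\<And>s. s \<in> S \<Longrightarrow> u s = c"
  shows "deriv u t = 0"
proof (rule DERIV_imp_deriv)
  show "(u has_real_derivative 0) (at t)"
    by (rule has_field_derivative_transform_within_open[of "\<lambda>_. c" _ _ S]) (use assms in auto)
qed

lemma smooth_scale_shift:
  fixes u :: "real \<Rightarrow> real"
  assumes "smooth u"
  shows "smooth (\<lambda>t. u (a * t + c))"
  using smooth_affine_compose[OF assms bounded_linear_mult_right] .

lemma bounded_smooth: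
  fixes u :: "real \<Rightarrow> real"
  assumes "smooth u" "\<And>t. r < \<bar>t\<bar> \<Longrightarrow> u t = 0"
  obtains C where "\<And>t. \<bar>u t\<bar> \<le> C" "\<And>t. \<bar>deriv u t\<bar> \<le> C"
proof -
  have "deriv u t = 0" if "r < \<bar>t\<bar>" for t
    using that assms(2)
    by (intro deriv_eq_0_open[of "{t. r < \<bar>t\<bar>}" t u 0] open_Collect_less continuous_intros) auto
  then have "has_compact_support (deriv u)"
    by (intro has_compact_supportI[of r]) auto
  then obtain D where "\<And>t. norm (deriv u t) \<le> D"
    using bounded_range_compact_support[OF continuous_on_deriv[OF assms(1)]] by blast
  moreover have "has_compact_support u"
    using assms(2) by (intro has_compact_supportI[of r]) auto
  then obtain C where "\<And>t. norm (u t) \<le> C"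
    using bounded_range_compact_support[OF smooth_continuous[OF assms(1)]] by blast
  ultimately show ?thesis
    by (intro that[of "max C D"]) (auto simp: le_max_iff_disj)
qed

lemma smooth_compose_nth:
  fixes u :: "real \<Rightarrow> real"
  assumes "smooth u"
  shows "smooth (\<lambda>z::real^'n::finite. u (z $ i))"
  using smooth_affine_compose[OF assms bounded_linear_vec_nth, of i 0] by simp

lemma test_function_product:
  fixes u v :: "real \<Rightarrow> real"
  assumes "smooth u" "smooth v" "i \<noteq> j"
    and u: "\<And>t. r < \<bar>t\<bar> \<Longrightarrow> u t = 0" and v: "\<And>t. r < \<bar>t\<bar> \<Longrightarrow> v t = 0"
  shows "test_function (\<lambda>z::real^2. u (z $ i) * v (z $ j))"
  unfolding test_function_iff
proof (intro conjI smooth_mult smooth_compose_nth assms(1,2))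
  show "has_compact_support (\<lambda>z::real^2. u (z $ i) * v (z $ j))"
  proof (rule has_compact_supportI)
    fix z :: "real^2"
    assume z: "2 * r < norm z"
    \<comment> \<open>The norm is at most the sum of the two absolute coordinates, so exceeding
      \<open>2 * r\<close> forces one of them beyond \<open>r\<close>.\<close>
    have "norm z \<le> (\<Sum>k\<in>UNIV. \<bar>z $ k\<bar>)"
      by (rule norm_le_l1_cart)
    also have "\<dots> = \<bar>z $ i\<bar> + \<bar>z $ j\<bar>"
      using assms(3) by (simp add: UNIV_2_eq[OF assms(3)])
    finally have "r < \<bar>z $ i\<bar> \<or> r < \<bar>z $ j\<bar>"
      using z by linarith
    then show "u (z $ i) * v (z $ j) = 0"
      using u v by auto
  qed
qed

lemma partial_product:
  fixes u v :: "real \<Rightarrow> real"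
  assumes "smooth u" "smooth v" "i \<noteq> j"
  shows "partial i (\<lambda>z::real^2. u (z $ i) * v (z $ j)) = (\<lambda>z. deriv u (z $ i) * v (z $ j))"
    "partial j (\<lambda>z::real^2. u (z $ i) * v (z $ j)) = (\<lambda>z. u (z $ i) * deriv v (z $ j))"
proof -
  have D: "((\<lambda>z::real^2. w (z $ k)) has_derivative (\<lambda>h. deriv w (z $ k) * h $ k)) (at z)"
    if "smooth w" for w :: "real \<Rightarrow> real" and k z
    using has_derivative_compose[OF bounded_linear_imp_has_derivative[OF bounded_linear_vec_nth]
        smooth_has_real_derivative[OF that, unfolded has_field_derivative_def]] .
  have "frechet_derivative (\<lambda>z::real^2. u (z $ i) * v (z $ j)) (at z)
      = (\<lambda>h. u (z $ i) * (deriv v (z $ j) * h $ j) + deriv u (z $ i) * h $ i * v (z $ j))" for z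
    using frechet_derivative_at[OF has_derivative_mult[OF D[OF assms(1)] D[OF assms(2)]]] by simp
  then show "partial i (\<lambda>z::real^2. u (z $ i) * v (z $ j)) = (\<lambda>z. deriv u (z $ i) * v (z $ j))"
    "partial j (\<lambda>z::real^2. u (z $ i) * v (z $ j)) = (\<lambda>z. u (z $ i) * deriv v (z $ j))"
    using assms(3) by (auto simp: fun_eq_iff partial_def axis_def)
qed

section \<open>Cutoffs that approximate points and half lines\<close>

section \<open>Smooth cutoffs\<close>

text \<open>It equals t on [-1, 1] and vanishes outside [-2, 2]. Hence hump (n t) / n tends to 0
  uniformly, while its derivative tends pointwise to the indicator of {0}.\<close>

definition hump :: "real \<Rightarrow> real"
  where "hump t = t * (step (2 + t) * step (2 - t))"

lemma smooth_step_shift: "smooth (\<lambda>t. step (c + t))" "smooth (\<lambda>t. step (c - t))"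
  using smooth_scale_shift[OF smooth_step, of 1 c] smooth_scale_shift[OF smooth_step, of "-1" c]
  by (simp_all add: add.commute)

lemma smooth_hump: "smooth hump"
  unfolding hump_def[abs_def]
  by (intro smooth_mult smooth_step_shift smooth_bounded_linear bounded_linear_ident)

lemma hump_eq_0: "2 < \<bar>t\<bar> \<Longrightarrow> hump t = 0"
  by (auto simp: hump_def abs_if step_eq_0 split: if_splits)

lemma deriv_hump: "deriv hump 0 = 1" "2 < \<bar>t\<bar> \<Longrightarrow> deriv hump t = 0"
proof -
  have "(hump has_real_derivative 1) (at 0)"
    by (rule has_field_derivative_transform_within_open[of "\<lambda>t. t" _ _ "{-1<..<1}"])
      (auto simp: hump_def step_eq_1)
  then show "deriv hump 0 = 1"
    by (rule DERIV_imp_deriv)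
  show "deriv hump t = 0" if "2 < \<bar>t\<bar>"
    using that hump_eq_0
    by (intro deriv_eq_0_open[of "{t. 2 < \<bar>t\<bar>}" t hump 0] open_Collect_less continuous_intros) auto
qed

text \<open>It is 1 up to distance 1 beyond the box, so its derivative vanishes on the box including
  the boundary.\<close>

definition plateau :: "real \<Rightarrow> real \<Rightarrow> real"
  where "plateau R t = step (2 + R + t) * step (2 + R - t)"

lemma smooth_plateau: "smooth (plateau R)"
  unfolding plateau_def[abs_def] by (intro smooth_mult smooth_step_shift)

lemma plateau_eq_0: "2 + R < \<bar>t\<bar> \<Longrightarrow> plateau R t = 0"
  by (auto simp: plateau_def abs_if step_eq_0 split: if_splits)

lemma plateau_eq_1: "\<bar>t\<bar> \<le> 1 + R \<Longrightarrow> plateau R t = 1"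
  by (simp add: plateau_def step_eq_1 abs_le_iff)

text \<open>The first factor drops from 1 at \<open>y\<close> to 0 at y + 1/(n+1). The second is 1
  from -R on and 0 left of -R - 1; it makes the support compact without changing values on the
  box.\<close>

definition ramp :: "real \<Rightarrow> real \<Rightarrow> nat \<Rightarrow> real \<Rightarrow> real"
  where "ramp R y n t = step (1 + real (Suc n) * (y - t)) * step (1 + R + t)"

lemma smooth_ramp: "smooth (ramp R y n)"
proof -
  have "smooth (\<lambda>t. step (- real (Suc n) * t + (1 + real (Suc n) * y)))"
    by (intro smooth_scale_shift smooth_step)
  moreover have "- real (Suc n) * t + (1 + real (Suc n) * y) = 1 + real (Suc n) * (y - t)" for t
    by (simp add: algebra_simps)
  ultimately have "smooth (\<lambda>t. step (1 + real (Suc n) * (y - t)))"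
    by (simp only:)
  then show ?thesis
    unfolding ramp_def[abs_def] by (intro smooth_mult smooth_step_shift)
qed

lemma ramp_eq_0_left: "t \<le> - 1 - R \<Longrightarrow> ramp R y n t = 0"
  by (simp add: ramp_def step_eq_0)

lemma ramp_eq_0_right:
  assumes "1 \<le> real (Suc n) * (t - y)"
  shows "ramp R y n t = 0"
proof -
  have "1 + real (Suc n) * (y - t) \<le> 0"
    using assms by (simp add: algebra_simps)
  then show ?thesis
    by (simp add: ramp_def step_eq_0)
qed

lemma ramp_eq_0:
  assumes "1 + \<bar>R\<bar> + \<bar>y\<bar> < \<bar>t\<bar>"
  shows "ramp R y n t = 0"
proof (cases "t \<ge> 0")
  case True
  then have "1 * 1 \<le> real (Suc n) * (t - y)"
    using assms by (intro mult_mono) auto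
  then show ?thesis
    using ramp_eq_0_right by simp
qed (use assms in \<open>auto intro: ramp_eq_0_left\<close>)

lemma ramp_bounds: "\<bar>ramp R y n t\<bar> \<le> 1"
  using step_bounds by (simp add: ramp_def abs_mult mult_le_one)

lemma ramp_tendsto:
  assumes "- R \<le> t"
  shows "(\<lambda>n. ramp R y n t) \<longlonglongrightarrow> indicator {..y} t"
proof (cases "t \<le> y")
  case True
  then have "ramp R y n t = 1" for n
    using assms by (simp add: ramp_def step_eq_1)
  then show ?thesis
    using True by simp
next
  case False
  \<comment> \<open>From index \<open>m\<close> on, the falling edge, of width 1/(n+1), ends no
    later than \<open>t\<close>.\<close>
  obtain m :: nat where m: "1 / (t - y) \<le> real m"
    using real_arch_simple by blast
  have "ramp R y n t = 0" if "n \<ge> m" for n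
  proof (rule ramp_eq_0_right)
    have "1 / (t - y) \<le> real (Suc n)"
      using m that by linarith
    then show "1 \<le> real (Suc n) * (t - y)"
      using False by (simp add: field_simps)
  qed
  then have "\<forall>\<^sub>F n in sequentially. ramp R y n t = 0"
    by (auto simp: eventually_sequentially)
  then show ?thesis
    using False by (simp add: tendsto_eventually)
qed

section \<open>Null sets and weak second derivatives for one row\<close>

section \<open>Rows of a divergence-free matrix of measures\<close>

text \<open>\<open>p\<close> is the diagonal entry and \<open>b\<close> the off-diagonal one. With
  abstract indices both rows become instances: (1, 2) for the first and (2, 1) for the
  second.\<close>

locale divergence_free_row =
  p: planar_signed_measure R Mp Np + b: planar_signed_measure R Mb Nb
  for R Mp Np Mb Nb +
  fixes i j :: 2
  assumes ij: "i \<noteq> j"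
    and div_free: "test_function g \<Longrightarrow>
      signed_integral Mp Np (partial i g) + signed_integral Mb Nb (partial j g) = 0"
begin

text \<open>Testing with the gradient of \<open>hump (n (z\<^sub>j - x)) / n * u z\<^sub>i\<close>: the \<open>i\<close>-th partial tends to \<open>0\<close> uniformly,
  while the \<open>j\<close>-th one concentrates on the line \<open>z\<^sub>j = x\<close>.\<close>

lemma line_smooth:
  assumes u: "smooth u" "\<And>t. r < \<bar>t\<bar> \<Longrightarrow> u t = 0"
  shows "b.\<I> (\<lambda>z. u (z $ i) * indicator {x} (z $ j)) = 0"
proof -
  \<comment> \<open>The outer division cancels the factor from the chain rule, and
    \<open>Suc n\<close> keeps the scale positive.\<close>
  define v where "v n t = hump (real (Suc n) * (t - x)) / real (Suc n)" for n t
  have smooth_v: "smooth (v n)" for n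
  proof -
    have "smooth (\<lambda>t. hump (real (Suc n) * t + - real (Suc n) * x))"
      by (intro smooth_scale_shift smooth_hump)
    then have "smooth (\<lambda>t. hump (real (Suc n) * (t - x)) * (1 / real (Suc n)))"
      by (intro smooth_mult smooth_const) (simp add: algebra_simps)
    then show ?thesis
      by (simp add: v_def[abs_def])
  qed
  have deriv_v: "deriv (v n) t = deriv hump (real (Suc n) * (t - x))" for n t
  proof (rule DERIV_imp_deriv)
    have "((\<lambda>t. hump (real (Suc n) * (t - x))) has_real_derivative
        deriv hump (real (Suc n) * (t - x)) * real (Suc n)) (at t)"
      by (rule DERIV_chain2[OF smooth_has_real_derivative[OF smooth_hump]])
        (auto intro!: derivative_eq_intros)
    from DERIV_cdivide[OF this, of "real (Suc n)"]
    show "(v n has_real_derivative deriv hump (real (Suc n) * (t - x))) (at t)"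
      by (simp add: v_def[abs_def])
  qed
  have far: "2 < \<bar>real (Suc n) * (t - x)\<bar>" if "2 + \<bar>x\<bar> < \<bar>t\<bar>" for n t
  proof -
    have "1 * \<bar>t - x\<bar> \<le> real (Suc n) * \<bar>t - x\<bar>"
      by (intro mult_right_mono) auto
    then show ?thesis
      using that by (simp add: abs_mult)
  qed
  obtain C where C: "\<And>t. \<bar>u t\<bar> \<le> C" "\<And>t. \<bar>deriv u t\<bar> \<le> C"
    using bounded_smooth[OF u] by blast
  obtain D where D: "\<And>t. \<bar>hump t\<bar> \<le> D" "\<And>t. \<bar>deriv hump t\<bar> \<le> D"
    using bounded_smooth[OF smooth_hump hump_eq_0] by blast
  have nonneg: "0 \<le> C" "0 \<le> D"
    using C(1)[of 0] D(1)[of 0] by linarith+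
  have v_bound: "\<bar>v n t\<bar> \<le> D / real (Suc n)" for n t
    using D(1) by (simp add: v_def divide_right_mono)
  \<comment> \<open>A bound free of \<open>n\<close>, to serve as the dominating constant.\<close>
  have v_bound': "\<bar>v n t\<bar> \<le> D" for n t
  proof -
    have "D / real (Suc n) \<le> D / 1"
      using nonneg by (intro divide_left_mono) auto
    then show ?thesis
      using v_bound[of n t] by simp
  qed
  have v_tendsto: "(\<lambda>n. v n t) \<longlonglongrightarrow> 0" for t
  proof (rule Lim_null_comparison)
    show "(\<lambda>n. D / real (Suc n)) \<longlonglongrightarrow> 0"
      using LIMSEQ_Suc[OF lim_const_over_n[of D]] by simp
  qed (use v_bound in auto)
  have deriv_v_tendsto: "(\<lambda>n. deriv (v n) t) \<longlonglongrightarrow> indicator {x} t" for t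
  proof (cases "t = x")
    case True
    then show ?thesis
      by (simp add: deriv_v deriv_hump)
  next
    case False
    \<comment> \<open>Any number above 2 would do in place of 3: for n beyond \<open>m\<close> the
      scaled argument leaves the interval [-2, 2].\<close>
    obtain m :: nat where m: "3 / \<bar>t - x\<bar> \<le> real m"
      using real_arch_simple by blast
    have "deriv (v n) t = 0" if "n \<ge> m" for n
    proof -
      have "3 / \<bar>t - x\<bar> \<le> real (Suc n)"
        using m that by linarith
      then have "3 \<le> \<bar>real (Suc n) * (t - x)\<bar>"
        using False by (simp add: pos_divide_le_eq abs_mult del: of_nat_Suc)
      then show ?thesis
        by (simp add: deriv_v deriv_hump del: of_nat_Suc)
    qed
    then show ?thesis
      using False by (intro tendsto_eventually) (auto simp: eventually_sequentially)
  qed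
  have cont: "continuous_on UNIV u" "continuous_on UNIV (deriv u)"
    "continuous_on UNIV (v n)" "continuous_on UNIV (deriv (v n))" for n
    using u(1) smooth_v by (auto intro: smooth_continuous continuous_on_deriv)
  have meas [measurable]: "u \<in> borel_measurable borel" "deriv u \<in> borel_measurable borel"
    "v n \<in> borel_measurable borel" "deriv (v n) \<in> borel_measurable borel" for n
    using cont by (auto intro: borel_measurable_continuous_onI)
  have "test_function (\<lambda>z::real^2. u (z $ i) * v n (z $ j))" for n
    using u far by (intro test_function_product[where r = "max r (2 + \<bar>x\<bar>)"] smooth_v ij)
      (auto simp: v_def hump_eq_0)
  from div_free[OF this]
  have eq: "b.\<I> (\<lambda>z. u (z $ i) * deriv (v n) (z $ j)) = - p.\<I> (\<lambda>z. deriv u (z $ i) * v n (z $ j))" for n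
    by (simp add: partial_product[OF u(1) smooth_v ij] eq_neg_iff_add_eq_0 add.commute)
  have "(\<lambda>n. p.\<I> (\<lambda>z. deriv u (z $ i) * v n (z $ j))) \<longlonglongrightarrow> p.\<I> (\<lambda>_. 0)"
  proof (rule p.tendsto)
    show "\<bar>deriv u (z $ i) * v n (z $ j)\<bar> \<le> C * D" for n and z :: "real^2"
      using C(2) v_bound' nonneg by (simp add: abs_mult mult_mono)
    show "(\<lambda>n. deriv u (z $ i) * v n (z $ j)) \<longlonglongrightarrow> 0" for z :: "real^2"
      using tendsto_mult_left[OF v_tendsto[of "z $ j"], of "deriv u (z $ i)"] by simp
  qed measurable
  from tendsto_minus[OF this] have "(\<lambda>n. b.\<I> (\<lambda>z. u (z $ i) * deriv (v n) (z $ j))) \<longlonglongrightarrow> 0"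
    unfolding eq p.zero by simp
  moreover have "(\<lambda>n. b.\<I> (\<lambda>z. u (z $ i) * deriv (v n) (z $ j)))
      \<longlonglongrightarrow> b.\<I> (\<lambda>z. u (z $ i) * indicator {x} (z $ j))"
  proof (rule b.tendsto)
    show "\<bar>u (z $ i) * deriv (v n) (z $ j)\<bar> \<le> C * D" for n and z :: "real^2"
      using C(1) D(2) nonneg by (simp add: abs_mult mult_mono deriv_v)
    show "(\<lambda>n. u (z $ i) * deriv (v n) (z $ j)) \<longlonglongrightarrow> u (z $ i) * indicator {x} (z $ j)" for z :: "real^2"
      by (intro tendsto_mult_left deriv_v_tendsto)
  qed measurable
  ultimately show ?thesis
    using LIMSEQ_unique by blast
qed

text \<open>\<open>line_smooth\<close> with the ramp as its smooth factor, followed by the limit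
  that turns the ramp into a half-line indicator on the box.\<close>

lemma half_line: "b.\<I> (\<lambda>z. indicator {..y} (z $ i) * indicator {x} (z $ j)) = 0"
proof -
  have "(\<lambda>n. b.\<I> (\<lambda>z. ramp R y n (z $ i) * indicator {x} (z $ j)))
      \<longlonglongrightarrow> b.\<I> (\<lambda>z. indicator {..y} (z $ i) * indicator {x} (z $ j))"
  proof (rule b.tendsto)
    have [measurable]: "ramp R y n \<in> borel_measurable borel" for n
      using smooth_continuous[OF smooth_ramp] by (rule borel_measurable_continuous_onI)
    show "(\<lambda>z::real^2. ramp R y n (z $ i) * indicator {x} (z $ j)) \<in> borel_measurable borel" for n
      by measurable
    show "\<bar>ramp R y n (z $ i) * indicator {x} (z $ j)\<bar> \<le> 1" for n and z :: "real^2"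
      using ramp_bounds by (simp add: indicator_def)
    show "(\<lambda>n. ramp R y n (z $ i) * indicator {x} (z $ j)) \<longlonglongrightarrow> indicator {..y} (z $ i) * indicator {x} (z $ j)"
      if "\<And>k. \<bar>z $ k\<bar> \<le> R" for z :: "real^2"
      using that[of i] by (intro tendsto_mult_right ramp_tendsto) (simp add: abs_le_iff)
  qed measurable
  moreover have "b.\<I> (\<lambda>z. ramp R y n (z $ i) * indicator {x} (z $ j)) = 0" for n
    using smooth_ramp ramp_eq_0 by (rule line_smooth)
  ultimately show ?thesis
    by (simp add: LIMSEQ_const_iff del: of_nat_Suc)
qed

text \<open>A point is the limit of differences of two half lines ending at y and at y - 1/(n+1),
  all of which are null.\<close>

lemma point: "b.\<I> (\<lambda>z. indicator {y} (z $ i) * indicator {x} (z $ j)) = 0"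
proof -
  let ?h = "\<lambda>y z. indicator {..y} (z $ i) * indicator {x} (z $ j) :: real"
  have meas: "?h t \<in> borel_measurable borel" for t
    by measurable
  have "(\<lambda>n. b.\<I> (\<lambda>z. ?h y z - ?h (y - 1 / real (Suc n)) z))
      \<longlonglongrightarrow> b.\<I> (\<lambda>z. indicator {y} (z $ i) * indicator {x} (z $ j))"
  proof (rule b.tendsto)
    show "\<bar>?h y z - ?h (y - 1 / real (Suc n)) z\<bar> \<le> 1" for n z
      by (simp add: indicator_def)
    show "(\<lambda>n. ?h y z - ?h (y - 1 / real (Suc n)) z) \<longlonglongrightarrow> indicator {y} (z $ i) * indicator {x} (z $ j)" for z
    proof (cases "z $ i < y")
      case True
      obtain m where m: "inverse (real (Suc m)) < y - z $ i"
        using reals_Archimedean[of "y - z $ i"] True by auto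
      have "z $ i \<le> y - 1 / real (Suc n)" if "n \<ge> m" for n
      proof -
        have "1 / real (Suc n) \<le> inverse (real (Suc m))"
          using that by (simp add: field_simps)
        with m show ?thesis
          by linarith
      qed
      then have "\<forall>\<^sub>F n in sequentially. ?h y z - ?h (y - 1 / real (Suc n)) z = 0"
        using True by (auto simp: eventually_sequentially intro!: exI[of _ m])
      then show ?thesis
        using True by (simp add: tendsto_eventually)
    next
      case False
      then have "\<not> z $ i \<le> y - 1 / real (Suc n)" for n
        by (simp add: not_le less_le_trans[of _ y])
      with False show ?thesis
        by (auto simp: indicator_def)
    qed
  qed measurable
  moreover have "b.\<I> (\<lambda>z. ?h y z - ?h t z) = 0" for t
    using b.diff[OF meas[of y], of 1 "?h t" 1] meas[of t] half_line[of y x] half_line[of t x]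
    by (simp add: indicator_def)
  ultimately show ?thesis
    by (simp add: LIMSEQ_const_iff del: of_nat_Suc)
qed

text \<open>Test with a primitive in direction \<open>j\<close> of plateau times ramp. On the box
  its \<open>i\<close>-th partial vanishes, so \<open>div_free\<close> gives zero for its
  \<open>j\<close>-th partial, which is the ramp there. The limit in \<open>n\<close> yields the
  half plane.\<close>

lemma half_plane: "b.\<I> (\<lambda>z. indicator {..y} (z $ j)) = 0"
proof -
  have [measurable]: "ramp R y n \<in> borel_measurable borel" for n
    using smooth_continuous[OF smooth_ramp] by (rule borel_measurable_continuous_onI)
  have "(\<lambda>n. b.\<I> (\<lambda>z. ramp R y n (z $ j))) \<longlonglongrightarrow> b.\<I> (\<lambda>z. indicator {..y} (z $ j))"
  proof (rule b.tendsto)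
    show "\<bar>ramp R y n (z $ j)\<bar> \<le> 1" for n and z :: "real^2"
      by (rule ramp_bounds)
    show "(\<lambda>n. ramp R y n (z $ j)) \<longlonglongrightarrow> indicator {..y} (z $ j)"
      if "\<And>k. \<bar>z $ k\<bar> \<le> R" for z :: "real^2"
      using that[of j] by (intro ramp_tendsto) (simp add: abs_le_iff)
  qed measurable
  moreover have "b.\<I> (\<lambda>z. ramp R y n (z $ j)) = 0" for n
  proof -
    define f where "f z = plateau R (z $ i) * ramp R y n (z $ j)" for z :: "real^2"
    \<comment> \<open>Shifting by \<open>T\<close> moves every \<open>j\<close>-th coordinate in
      [-R, R] to at most -R - 2, where the ramp vanishes.\<close>
    define T where "T = 2 * R + 2"
    have T: "T \<ge> 0"
      using p.R_nonneg by (simp add: T_def)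
    let ?g = "sweep T (axis j 1) f"
    have f: "test_function f"
      unfolding f_def[abs_def]
      using p.R_nonneg by (intro test_function_product[where r = "2 + R + \<bar>y\<bar>"] smooth_plateau smooth_ramp ij)
        (auto intro: plateau_eq_0 ramp_eq_0)
    have test: "test_function (partial k ?g)" for k
      using f by (intro test_function_partial test_function_sweep)
    have meas_g: "partial k ?g \<in> borel_measurable borel" for k
      using test_function_continuous[OF test] by (rule borel_measurable_continuous_onI)
    have "p.\<I> (partial i ?g) = p.\<I> (\<lambda>_. 0)"
    proof (rule p.cong)
      fix z :: "real^2"
      assume z: "\<And>k. \<bar>z $ k\<bar> \<le> R"
      \<comment> \<open>The sweep moves points only in direction \<open>j\<close>, so the
        \<open>i\<close>-th coordinate stays where the plateau is constant.\<close>
      have "partial i f (z - s *\<^sub>R axis j 1) = 0" for s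
      proof -
        have "deriv (plateau R) (z $ i) = 0"
          using z[of i] by (intro deriv_eq_0_open[of "{- (1 + R)<..<1 + R}" _ _ 1])
            (auto simp: plateau_eq_1 abs_le_iff)
        then show ?thesis
          using ij by (simp add: f_def[abs_def] partial_product[OF smooth_plateau smooth_ramp ij] axis_def)
      qed
      then show "partial i ?g z = 0"
        by (simp add: partial_sweep[OF f] sweep_def)
    qed (use meas_g in auto)
    then have "b.\<I> (partial j ?g) = 0"
      using div_free[OF test_function_sweep[OF f], of T "axis j 1"] by (simp add: p.zero)
    moreover have "b.\<I> (partial j ?g) = b.\<I> (\<lambda>z. ramp R y n (z $ j))"
    proof (rule b.cong[OF meas_g])
      fix z :: "real^2"
      assume z: "\<And>k. \<bar>z $ k\<bar> \<le> R"
      have "f (z - T *\<^sub>R axis j 1) = 0"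
        using z[of j] by (simp add: f_def T_def ramp_eq_0_left)
      then show "partial j ?g z = ramp R y n (z $ j)"
        using z[of i] by (simp add: partial_sweep_axis[OF f T] f_def plateau_eq_1)
    qed measurable
    ultimately show ?thesis
      by simp
  qed
  ultimately show ?thesis
    by (simp add: LIMSEQ_const_iff del: of_nat_Suc)
qed

end

context divergence_free_row
begin

text \<open>The sweep is a primitive of \<open>f\<close> only over the strip where the
  \<open>i\<close>-th coordinate is at most \<open>R\<close> in absolute value. The assumption
  \<open>zero\<close> makes this enough: elsewhere the quadrant mass removes the error term from the
  integral.\<close>

lemma integral_second_partial:
  assumes f: "test_function f"
    and zero: "\<And>z k. R < \<bar>z $ k\<bar> \<Longrightarrow> b.\<I> (indicator (quadrant z)) = 0"
  shows "p.\<I> f = - (\<integral>z. b.\<I> (indicator (quadrant z)) * partial j (partial j f) z \<partial>lborel)"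
proof -
  let ?h = "partial j (partial j f)"
  have h: "test_function ?h"
    using f by (intro test_function_partial)
  obtain r where r: "r > 0" "\<And>z. r < norm z \<Longrightarrow> f z = 0"
    using f unfolding test_function_iff by (auto elim: has_compact_supportE)
  obtain r' where r': "r' > 0" "\<And>z. r' < norm z \<Longrightarrow> ?h z = 0"
    using h unfolding test_function_iff by (auto elim: has_compact_supportE)
  \<comment> \<open>The shift takes any point with \<open>i\<close>-th coordinate in [-R, R] out of
    the supports of both \<open>f\<close> and \<open>?h\<close>.\<close>
  define T where "T = R + r + r'"
  have T: "T \<ge> 0"
    using p.R_nonneg r(1) r'(1) by (simp add: T_def)
  have far: "f (z - T *\<^sub>R axis i 1) = 0" "?h (z - T *\<^sub>R axis i 1) = 0" if "\<bar>z $ i\<bar> \<le> R" for z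
  proof -
    have "r + r' \<le> \<bar>(z - T *\<^sub>R axis i 1) $ i\<bar>"
      using that by (simp add: T_def)
    then have "r + r' \<le> norm (z - T *\<^sub>R axis i 1)"
      using component_le_norm_cart order_trans by blast
    then show "f (z - T *\<^sub>R axis i 1) = 0" "?h (z - T *\<^sub>R axis i 1) = 0"
      using r r' by auto
  qed
  let ?g = "sweep T (axis i 1) f"
  have g: "test_function ?g"
    using f by (rule test_function_sweep)
  have "p.\<I> f = p.\<I> (partial i ?g)"
    by (rule p.cong)
      (auto intro!: borel_measurable_continuous_onI test_function_continuous test_function_partial f g
        simp: partial_sweep_axis[OF f T] far)
  also have "\<dots> = - b.\<I> (partial j ?g)"
    using div_free[OF g] by simp
  also have "b.\<I> (partial j ?g)
      = (\<integral>z. b.\<I> (indicator (quadrant z)) * partial i (partial j (partial j ?g)) z \<partial>lborel)"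
    by (rule b.quadrant_measure_mixed_partial[OF test_function_partial[OF g] ij, symmetric])
  \<comment> \<open>Partial derivatives commute with sweeping, which brings the outer
    \<open>i\<close>-th partial directly onto a sweep in direction \<open>i\<close>.\<close>
  also have "partial j (partial j ?g) = sweep T (axis i 1) ?h"
    by (simp add: partial_sweep f test_function_partial)
  also have "(\<integral>z. b.\<I> (indicator (quadrant z)) * partial i (sweep T (axis i 1) ?h) z \<partial>lborel)
      = (\<integral>z. b.\<I> (indicator (quadrant z)) * ?h z \<partial>lborel)"
  proof (intro Bochner_Integration.integral_cong refl)
    fix z
    show "b.\<I> (indicator (quadrant z)) * partial i (sweep T (axis i 1) ?h) z
        = b.\<I> (indicator (quadrant z)) * ?h z"
      using zero[of z i] far(2)[of z]
      by (cases "\<bar>z $ i\<bar> \<le> R") (simp_all add: partial_sweep_axis[OF h T])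
  qed
  finally show ?thesis .
qed

end

section \<open>Continuity, support and weak second derivatives of the potential\<close>

section \<open>The potential of a symmetric divergence-free matrix\<close>

text \<open>Symmetry is encoded by sharing the pair \<open>Mb\<close>, \<open>Nb\<close> between the
  rows; the null-set lemmas of both rows thus speak of the same measure, in the two coordinate
  directions.\<close>

locale symmetric_divergence_free =
  row1: divergence_free_row R Ma Na Mb Nb 1 2 +
  row2: divergence_free_row R Me Ne Mb Nb 2 1
  for R Ma Na Mb Nb Me Ne
begin

text \<open>The minus sign makes the mixed second derivative equal to - b in the weak sense, as the
  rotated gradient of the curl demands.\<close>

definition potential :: "real^2 \<Rightarrow> real"
  where "potential z = - row1.b.\<I> (indicator (quadrant z))"

text \<open>Below -R in some coordinate the quadrant misses the box. Above R in one coordinate it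
  meets the box in the same set as a half plane in the other coordinate, which is null.\<close>

lemma potential_outside:
  assumes "R < \<bar>z $ k\<bar>"
  shows "row1.b.\<I> (indicator (quadrant z)) = 0"
proof -
  have low: ?thesis if "z $ m < - R" for m
  proof -
    have "row1.b.\<I> (indicator (quadrant z)) = row1.b.\<I> (\<lambda>_. 0)"
    proof (rule row1.b.cong)
      fix w :: "real^2"
      assume "\<And>k. \<bar>w $ k\<bar> \<le> R"
      from this[of m] that show "indicator (quadrant z) w = (0::real)"
        by (auto simp: quadrant_def indicator_def intro!: exI[of _ m])
    qed auto
    then show ?thesis
      by (simp add: row1.b.zero)
  qed
  have high: ?thesis if "R < z $ m" "m \<noteq> m'" and null: "row1.b.\<I> (\<lambda>w. indicator {..z $ m'} (w $ m')) = 0" for m m'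
  proof -
    have "row1.b.\<I> (indicator (quadrant z)) = row1.b.\<I> (\<lambda>w. indicator {..z $ m'} (w $ m'))"
    proof (rule row1.b.cong)
      fix w :: "real^2"
      assume "\<And>k. \<bar>w $ k\<bar> \<le> R"
      from this[of m] that(1) show "indicator (quadrant z) w = (indicator {..z $ m'} (w $ m') :: real)"
        by (auto simp: quadrant_def indicator_def forall_2_iff[OF that(2)])
    qed measurable
    then show ?thesis
      using null by simp
  qed
  consider "z $ k < - R" | "R < z $ k" "k = 1" | "R < z $ k" "k = 2"
    using assms exhaust_2[of k] by linarith
  then show ?thesis
    using low high[of 1 2] high[of 2 1] row1.half_plane row2.half_plane by cases auto
qed

text \<open>Off the two coordinate lines through \<open>z\<close> the indicators of the quadrants converge pointwise; these lines
  carry no mass.\<close>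

lemma continuous_potential: "continuous_on UNIV potential"
proof -
  have "(\<lambda>n. row1.b.\<I> (indicator (quadrant (s n)))) \<longlonglongrightarrow> row1.b.\<I> (indicator (quadrant z))"
    if s: "s \<longlonglongrightarrow> z" for s :: "nat \<Rightarrow> real^2" and z
  proof -
    \<comment> \<open>\<open>off\<close> removes both coordinate lines through \<open>z\<close>;
      \<open>l1\<close> and \<open>l2\<close> are the half lines in them and \<open>pt\<close> is
      their crossing.\<close>
    define off :: "real^2 \<Rightarrow> real" where "off w = of_bool (w $ 1 \<noteq> z $ 1 \<and> w $ 2 \<noteq> z $ 2)" for w
    define l1 :: "real \<Rightarrow> real^2 \<Rightarrow> real" where "l1 t w = indicator {..t} (w $ 2) * indicator {z $ 1} (w $ 1)" for t and w :: "real^2"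
    define l2 :: "real \<Rightarrow> real^2 \<Rightarrow> real" where "l2 t w = indicator {..t} (w $ 1) * indicator {z $ 2} (w $ 2)" for t and w :: "real^2"
    define pt :: "real^2 \<Rightarrow> real" where "pt w = indicator {z $ 1} (w $ 1) * indicator {z $ 2} (w $ 2)" for w :: "real^2"
    have [measurable]: "off \<in> borel_measurable borel" "l1 t \<in> borel_measurable borel"
      "l2 t \<in> borel_measurable borel" "pt \<in> borel_measurable borel" for t
      unfolding off_def[abs_def] l1_def[abs_def] l2_def[abs_def] pt_def[abs_def] by measurable
    have null: "row1.b.\<I> (l1 t) = 0" "row1.b.\<I> (l2 t) = 0" "row1.b.\<I> pt = 0" for t
      using row2.half_line[of t "z $ 1"] row1.half_line[of t "z $ 2"] row1.point[of "z $ 1" "z $ 2"]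
      by (simp_all add: l1_def[abs_def] l2_def[abs_def] pt_def[abs_def])
    have remove: "row1.b.\<I> (indicator (quadrant y)) = row1.b.\<I> (\<lambda>w. indicator (quadrant y) w * off w)" for y
    proof -
      \<comment> \<open>These record whether \<open>quadrant y\<close> meets each of the two lines.
        The decomposition below is inclusion-exclusion: the crossing is counted in both half lines
        and subtracted once.\<close>
      define \<alpha> \<beta> :: real where "\<alpha> = of_bool (z $ 1 \<le> y $ 1)" and "\<beta> = of_bool (z $ 2 \<le> y $ 2)"
      have bnd: "\<bar>\<alpha> * l1 (y $ 2) w\<bar> \<le> 1" "\<bar>\<beta> * l2 (y $ 1) w\<bar> \<le> 1" "\<bar>\<alpha> * \<beta> * pt w\<bar> \<le> 1"
        "\<bar>indicator (quadrant y) w * off w\<bar> \<le> 1" for w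
        by (simp_all add: \<alpha>_def \<beta>_def l1_def l2_def pt_def off_def indicator_def)
      have triangle: "\<bar>p + q\<bar> \<le> C + D" if "\<bar>p\<bar> \<le> C" "\<bar>q\<bar> \<le> D" for p q C D :: real
        using that by linarith
      note bnd' = triangle[OF bnd(4) bnd(1)] triangle[OF triangle[OF bnd(4) bnd(1)] bnd(2)]
      have scale: "row1.b.\<I> (\<lambda>w. a * h w) = a * row1.b.\<I> h" for a h
        by (simp add: signed_integral_def right_diff_distrib)
      let ?f = "\<lambda>w. indicator (quadrant y) w * off w"
      have "indicator (quadrant y) = (\<lambda>w. ((?f w + \<alpha> * l1 (y $ 2) w) + \<beta> * l2 (y $ 1) w) - \<alpha> * \<beta> * pt w)"
        by (auto simp: fun_eq_iff \<alpha>_def \<beta>_def l1_def l2_def pt_def off_def indicator_def quadrant_def forall_2)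
      then have "row1.b.\<I> (indicator (quadrant y)) =
          row1.b.\<I> (\<lambda>w. ((?f w + \<alpha> * l1 (y $ 2) w) + \<beta> * l2 (y $ 1) w) - \<alpha> * \<beta> * pt w)"
        by (rule arg_cong)
      moreover have "row1.b.\<I> (\<lambda>w. ((?f w + \<alpha> * l1 (y $ 2) w) + \<beta> * l2 (y $ 1) w) - \<alpha> * \<beta> * pt w)
          = row1.b.\<I> (\<lambda>w. (?f w + \<alpha> * l1 (y $ 2) w) + \<beta> * l2 (y $ 1) w) - row1.b.\<I> (\<lambda>w. \<alpha> * \<beta> * pt w)"
        by (rule row1.b.diff, measurable, rule bnd'(2), measurable, rule bnd(3))
      moreover have "row1.b.\<I> (\<lambda>w. (?f w + \<alpha> * l1 (y $ 2) w) + \<beta> * l2 (y $ 1) w)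
          = row1.b.\<I> (\<lambda>w. ?f w + \<alpha> * l1 (y $ 2) w) + row1.b.\<I> (\<lambda>w. \<beta> * l2 (y $ 1) w)"
        by (rule row1.b.add, measurable, rule bnd'(1), measurable, rule bnd(2))
      moreover have "row1.b.\<I> (\<lambda>w. ?f w + \<alpha> * l1 (y $ 2) w) = row1.b.\<I> ?f + row1.b.\<I> (\<lambda>w. \<alpha> * l1 (y $ 2) w)"
        by (rule row1.b.add, measurable, rule bnd(4), measurable, rule bnd(1))
      ultimately show ?thesis
        by (simp only: scale null mult_zero_right add_0_right diff_zero)
    qed
    have "(\<lambda>n. row1.b.\<I> (\<lambda>w. indicator (quadrant (s n)) w * off w))
        \<longlonglongrightarrow> row1.b.\<I> (\<lambda>w. indicator (quadrant z) w * off w)"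
    proof (rule row1.b.tendsto)
      show "\<bar>indicator (quadrant (s n)) w * off w\<bar> \<le> 1" for n w
        by (simp add: off_def indicator_def)
      show "(\<lambda>n. indicator (quadrant (s n)) w * off w) \<longlonglongrightarrow> indicator (quadrant z) w * off w" for w
      proof (cases "off w = 0")
        case False
        \<comment> \<open>No coordinate of \<open>w\<close> equals that of \<open>z\<close>, so each
          comparison is strict in the limit and hence eventually constant.\<close>
        have "\<forall>\<^sub>F n in sequentially. (w $ k \<le> s n $ k) = (w $ k \<le> z $ k)" for k
        proof -
          have lim: "(\<lambda>n. s n $ k) \<longlonglongrightarrow> z $ k"
            using s by (rule tendsto_vec_nth)
          have "w $ k \<noteq> z $ k"
            using False exhaust_2[of k] by (auto simp: off_def)
          then consider "w $ k < z $ k" | "z $ k < w $ k"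
            by linarith
          then show ?thesis
          proof cases
            case 1
            then show ?thesis
              using order_tendstoD(1)[OF lim 1] by (auto elim!: eventually_mono)
          next
            case 2
            then show ?thesis
              using order_tendstoD(2)[OF lim 2] by (auto elim!: eventually_mono)
          qed
        qed
        from eventually_conj[OF this[of 1] this[of 2]]
        have "\<forall>\<^sub>F n in sequentially. indicator (quadrant (s n)) w * off w = indicator (quadrant z) w * off w"
          by (rule eventually_mono) (auto simp: quadrant_def indicator_def forall_2)
        then show ?thesis
          by (rule tendsto_eventually)
      qed simp
    qed measurable
    then show ?thesis
      by (simp only: remove[symmetric])
  qed
  then show ?thesis
    unfolding potential_def[abs_def] continuous_on_sequentially
    by (auto simp: comp_def intro!: tendsto_minus)
qed

lemma has_compact_support_potential: "has_compact_support potential"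
proof (rule has_compact_supportI)
  fix z :: "real^2"
  assume z: "2 * R < norm z"
  have "norm z \<le> \<bar>z $ 1\<bar> + \<bar>z $ 2\<bar>"
    using norm_le_l1_cart[of z] by (simp add: sum_2)
  with z have "R < \<bar>z $ 1\<bar> \<or> R < \<bar>z $ 2\<bar>"
    by linarith
  then show "potential z = 0"
    using potential_outside[of z] by (auto simp: potential_def)
qed

text \<open>Weak form of a = \<open>c_yy\<close>, e = \<open>c_xx\<close>, b = -
  \<open>c_xy\<close>. The mixed identity is stated in both orders, since both occur in the gradient
  of the curl and symmetry of second derivatives is thereby avoided.\<close>

lemma integral_potential_partial:
  assumes "test_function f"
  shows "row1.p.\<I> f = (\<integral>z. potential z * partial 2 (partial 2 f) z \<partial>lborel)"
    "row2.p.\<I> f = (\<integral>z. potential z * partial 1 (partial 1 f) z \<partial>lborel)"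
    "row1.b.\<I> f = - (\<integral>z. potential z * partial 1 (partial 2 f) z \<partial>lborel)"
    "row1.b.\<I> f = - (\<integral>z. potential z * partial 2 (partial 1 f) z \<partial>lborel)"
  using row1.integral_second_partial[OF assms potential_outside] row2.integral_second_partial[OF assms potential_outside]
    row1.b.quadrant_measure_mixed_partial[OF assms, of 1 2] row1.b.quadrant_measure_mixed_partial[OF assms, of 2 1]
  by (simp_all add: potential_def)

end

section \<open>From the measures back to the operator\<close>

section \<open>Operators on test functions\<close>

lemma apply_C0: "f \<in> vanishing_functions \<Longrightarrow> apply_c0 (C0 f) = f"
  by (rule C0_inverse)

lemma apply_C0_test_function: "test_function f \<Longrightarrow> apply_c0 (C0 f) = f"
  by (intro apply_C0 test_function_vanishing)

text \<open>Placing a scalar test function in one slot isolates a single matrix entry of the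
  operator.\<close>

lemma test_function_axis:
  fixes f :: "'a::euclidean_space \<Rightarrow> real"
  assumes "test_function f"
  shows "test_function (\<lambda>x. f x *\<^sub>R (axis k 1 :: real^'n::finite))"
proof -
  obtain r where "\<And>x. r < norm x \<Longrightarrow> f x = 0"
    using assms has_compact_supportE unfolding test_function_iff by blast
  then have "has_compact_support (\<lambda>x. f x *\<^sub>R (axis k 1 :: real^'n))"
    by (intro has_compact_supportI[of r]) auto
  then show ?thesis
    using assms
    by (simp add: test_function_iff smooth_def Ck_bounded_linear_compose[OF bounded_linear_scaleR_left])
qed

lemma curl_partials:
  assumes "test_function U"
  shows "partial k (curl U) x = partial k (partial 1 (\<lambda>y. U y $ 2)) x - partial k (partial 2 (\<lambda>y. U y $ 1)) x"
proof -
  have "smooth (partial m (\<lambda>y. U y $ l))" for m l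
    using test_function_partial[OF test_function_component[OF assms]] by (simp add: test_function_iff)
  from has_derivative_diff[OF smooth_has_derivative[OF this] smooth_has_derivative[OF this]]
  have "frechet_derivative (\<lambda>y. partial 1 (\<lambda>y. U y $ 2) y - partial 2 (\<lambda>y. U y $ 1) y) (at x)
      = (\<lambda>v. frechet_derivative (partial 1 (\<lambda>y. U y $ 2)) (at x) v
        - frechet_derivative (partial 2 (\<lambda>y. U y $ 1)) (at x) v)"
    by (rule frechet_derivative_at[symmetric])
  then show ?thesis
    by (simp add: partial_def[of k] curl_def[abs_def])
qed

theorem theorem5p1:
  fixes A :: "(real^2, real^2) c0 \<Rightarrow>\<^sub>L (real^2)"
  assumes compact_supp: "compactly_supported_operator A"
    and symmetric: "\<exists>(a :: (real^2, real) c0 \<Rightarrow>\<^sub>L real) (b :: (real^2, real) c0 \<Rightarrow>\<^sub>L real)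
        (e :: (real^2, real) c0 \<Rightarrow>\<^sub>L real). \<forall>U.
      A U = vector [a (c0_component 1 U) + b (c0_component 2 U),
                    b (c0_component 1 U) + e (c0_component 2 U)]"
    and annihilates_gradients: "\<forall>g :: real^2 \<Rightarrow> real. test_function g \<longrightarrow> A (C0 (grad g)) = 0"
  shows "\<exists>c :: real^2 \<Rightarrow> real. continuous_on UNIV c \<and> has_compact_support c \<and>
    (\<forall>U :: real^2 \<Rightarrow> real^2. test_function U \<longrightarrow>
      A (C0 U) = (\<integral>x. c x *\<^sub>R rot90 (grad (curl U) x) \<partial>lborel))"
proof -
  obtain M N :: "2 \<Rightarrow> 2 \<Rightarrow> (real^2) measure" where
    fin: "\<And>k l. finite_borel_measure (M k l)" "\<And>k l. finite_borel_measure (N k l)"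
    and rep: "\<And>U k. A U $ k = (\<Sum>l\<in>UNIV. (\<integral>x. U x $ l \<partial>M k l) - (\<integral>x. U x $ l \<partial>N k l))"
    and supp: "\<And>k l. compact (signed_support (M k l) (N k l))"
    using compact_supp unfolding compactly_supported_operator_def by blast
  have "bounded (\<Union>k. \<Union>l. signed_support (M k l) (N k l))"
    using supp by (intro bounded_UN ballI compact_imp_bounded) auto
  \<comment> \<open>One radius for all four entries, so that they share a single box.\<close>
  then obtain R where R: "R > 0"
    "\<forall>x\<in>\<Union>k. \<Union>l. signed_support (M k l) (N k l). norm x \<le> R"
    unfolding bounded_pos by blast
  define K where "K = {x::real^2. \<forall>k. \<bar>x $ k\<bar> \<le> R}"
  have "closed K"
    unfolding K_def by (intro closed_Collect_all closed_Collect_le continuous_intros)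
  then have K: "K \<in> sets borel"
    by (rule borel_closed)
  have sub: "signed_support (M k l) (N k l) \<subseteq> K" for k l
  proof
    fix x assume "x \<in> signed_support (M k l) (N k l)"
    then have "norm x \<le> R"
      using R(2) by blast
    then show "x \<in> K"
      unfolding K_def using component_le_norm_cart order_trans by blast
  qed
  \<comment> \<open>Cut down to the box, each measure of a pair is concentrated there, and by
    \<open>comp\<close> the operator is unchanged.\<close>
  let ?M = "\<lambda>k l. restrict_measure (M k l) K"
  let ?N = "\<lambda>k l. restrict_measure (N k l) K"
  let ?S = "\<lambda>k l. signed_integral (?M k l) (?N k l)"
  have planar: "planar_signed_measure R (?M k l) (?N k l)" for k l
    using R(1) AE_restrict_measure[OF fin(1) K] AE_restrict_measure[OF fin(2) K]
      finite_borel_restrict_measure[OF fin(1) K] finite_borel_restrict_measure[OF fin(2) K]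
    by unfold_locales (auto simp: K_def)
  have comp: "A (C0 U) $ k = ?S k 1 (\<lambda>x. U x $ 1) + ?S k 2 (\<lambda>x. U x $ 2)"
    if U: "U \<in> vanishing_functions" for U k
  proof -
    have "?S k l (\<lambda>x. U x $ l) = (\<integral>x. U x $ l \<partial>M k l) - (\<integral>x. U x $ l \<partial>N k l)" for l
    proof -
      obtain C where C: "\<And>x. norm (U x) \<le> C"
        using vanishing_functions_bounded[OF U] by (auto simp: bounded_iff)
      have "(\<lambda>x. U x $ l) \<in> borel_measurable borel"
        using U by (intro borel_measurable_continuous_onI continuous_on_component)
          (simp add: vanishing_functions_def)
      moreover have "\<bar>U x $ l\<bar> \<le> C" for x
        using C component_le_norm_cart order_trans by blast
      ultimately show ?thesis
        by (subst signed_integral_restrict_measure[OF fin K sub]) (auto simp: signed_integral_def)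
    qed
    then show ?thesis
      by (simp add: rep apply_C0[OF U] sum_2)
  qed
  \<comment> \<open>The functionals in \<open>symmetric\<close> and the measures representing
    \<open>A\<close> come from separate hypotheses. Evaluating \<open>A\<close> on f e_2 and f e_1
    identifies both off-diagonal entries with \<open>b\<close> on test functions.\<close>
  have sym: "?S 1 2 f = ?S 2 1 f" if f: "test_function f" for f
  proof -
    obtain a b e :: "(real^2, real) c0 \<Rightarrow>\<^sub>L real" where
      A: "\<And>U. A U = vector [a (c0_component 1 U) + b (c0_component 2 U),
                    b (c0_component 1 U) + e (c0_component 2 U)]"
      using symmetric by blast
    define V :: "2 \<Rightarrow> real^2 \<Rightarrow> real^2" where "V k = (\<lambda>x. f x *\<^sub>R axis k 1)" for k
    have V: "test_function (V k)" for k
      unfolding V_def using f by (rule test_function_axis)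
    have "c0_component l (C0 (V k)) = (if l = k then C0 f else 0)" for k l
      by (rule c0_eqI, simp add: c0_component.rep_eq apply_C0_test_function[OF V] apply_C0_test_function[OF f])
        (simp add: V_def axis_def)
    then have "A (C0 (V 2)) $ 1 = b (C0 f)" "A (C0 (V 1)) $ 2 = b (C0 f)"
      by (simp_all add: A blinfun.zero_right)
    moreover have "A (C0 (V 2)) $ 1 = ?S 1 2 f" "A (C0 (V 1)) $ 2 = ?S 2 1 f"
      using comp[OF test_function_vanishing[OF V]]
      by (simp_all add: V_def axis_def signed_integral_def)
    ultimately show ?thesis
      by simp
  qed
  have div: "?S k 1 (partial 1 g) + ?S k 2 (partial 2 g) = 0" if g: "test_function g" for g k
    using comp[OF grad_test_function_vanishing[OF g], of k] annihilates_gradients g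
    by (simp add: grad_def)
  \<comment> \<open>Partials of test functions are test functions, so \<open>sym\<close> may replace
    entry (2, 1) by entry (1, 2) in the second row.\<close>
  have div_sym: "?S 1 2 (partial 1 g) + ?S 2 2 (partial 2 g) = 0" if g: "test_function g" for g
    using div[OF g, of 2] sym[OF test_function_partial[OF g], of 1] by simp
  interpret symmetric_divergence_free R "?M 1 1" "?N 1 1" "?M 1 2" "?N 1 2" "?M 2 2" "?N 2 2"
  proof -
    interpret a: planar_signed_measure R "?M 1 1" "?N 1 1" by (rule planar)
    interpret b: planar_signed_measure R "?M 1 2" "?N 1 2" by (rule planar)
    interpret e: planar_signed_measure R "?M 2 2" "?N 2 2" by (rule planar)
    show "symmetric_divergence_free R (?M 1 1) (?N 1 1) (?M 1 2) (?N 1 2) (?M 2 2) (?N 2 2)"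
      by unfold_locales (simp_all add: div div_sym add.commute)
  qed
  have "A (C0 U) = (\<integral>x. potential x *\<^sub>R rot90 (grad (curl U) x) \<partial>lborel)"
    if U: "test_function U" for U
  proof -
    have tU: "test_function (\<lambda>x. U x $ k)" for k
      using U by (rule test_function_component)
    let ?D = "\<lambda>k l m x. partial k (partial l (\<lambda>y. U y $ m)) x"
    have cont: "continuous_on UNIV (?D k l m)" for k l m
      by (intro test_function_continuous test_function_partial tU)
    obtain r where r: "\<And>x. r < norm x \<Longrightarrow> potential x = 0"
      using has_compact_support_potential by (rule has_compact_supportE) blast
    \<comment> \<open>Needed to split the integral of a difference, since the Bochner integral of a
      non-integrable function is 0 by default.\<close>
    have int: "integrable lborel (\<lambda>x. potential x * ?D k l m x)" for k l m
      using r by (intro integrable_compact_support continuous_on_mult continuous_potential cont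
          has_compact_supportI[of r]) auto
    have rot: "rot90 (grad (curl U) x) = vector [?D 2 2 1 x - ?D 2 1 2 x, ?D 1 1 2 x - ?D 1 2 1 x]" for x
      by (simp add: rot90_def grad_def curl_partials[OF U])
    have cont_rot: "continuous_on UNIV (\<lambda>x. rot90 (grad (curl U) x))"
    proof -
      have "continuous_on UNIV (\<lambda>x. rot90 (grad (curl U) x) $ k)" for k
        using exhaust_2[of k] by (auto simp: rot intro!: continuous_on_diff cont)
      then show ?thesis
        using continuous_on_vec_lambda[of UNIV "\<lambda>k x. rot90 (grad (curl U) x) $ k"] by simp
    qed
    have int_rot: "integrable lborel (\<lambda>x. potential x *\<^sub>R rot90 (grad (curl U) x))"
      using r by (intro integrable_compact_support continuous_on_scaleR continuous_potential cont_rot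
          has_compact_supportI[of r]) auto
    have "(\<integral>x. potential x *\<^sub>R rot90 (grad (curl U) x) \<partial>lborel) $ k
        = (\<integral>x. potential x * rot90 (grad (curl U) x) $ k \<partial>lborel)" for k
      using integral_bounded_linear[OF bounded_linear_vec_nth int_rot, of k] by simp
    then have "(\<integral>x. potential x *\<^sub>R rot90 (grad (curl U) x) \<partial>lborel) $ 1
          = (\<integral>x. potential x * ?D 2 2 1 x \<partial>lborel) - (\<integral>x. potential x * ?D 2 1 2 x \<partial>lborel)"
        "(\<integral>x. potential x *\<^sub>R rot90 (grad (curl U) x) \<partial>lborel) $ 2
          = (\<integral>x. potential x * ?D 1 1 2 x \<partial>lborel) - (\<integral>x. potential x * ?D 1 2 1 x \<partial>lborel)"
      using int by (simp_all add: rot right_diff_distrib)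
    \<comment> \<open>The four integrals are a(U_1), - b(U_2), e(U_2) and - b(U_1), in the order of
      their appearance above.\<close>
    then show ?thesis
      using integral_potential_partial[OF tU] sym[OF tU]
      by (simp add: vec_eq_iff forall_2 comp[OF test_function_vanishing[OF U]])
  qed
  then show ?thesis
    using continuous_potential has_compact_support_potential by blast
qed

end
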